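(* Let $q=p^e$ be a power of a prime $p$ ($e>0$), let $K=\mathbb{F}_q(\theta)$ with $\theta$ an indeterminate, equipped with the absolute value $|a|=q^{\deg_\theta a}$. Let $C$ be the completion of an algebraic closure of $K_\infty=\mathbb{F}_q((1/\theta))$ (with the unique extension of $|\cdot|$), and let $K^{\mathrm{alg}}$ be the algebraic closure of $K$ in $C$. Let $$f_{\mathrm{De}}(x)=\prod_{n=1}^\infty\bigl(1-\theta x^{q^n}\bigr),$$ which converges for all $x\in C$ with $|x|<1$. Then for every $\alpha\in K^{\mathrm{alg}}$ with $0<|\alpha|<1$, the element $f_{\mathrm{De}}(\alpha)\in C$ is transcendental over $K$.
   Formalization: The formal theorem additionally assumes θα^(q^n) ≠ 1 for all n ≥ 1; this is needed because for α = θ^(-1/q^n) a factor vanishes and f_De(α) = 0 is algebraic, and it excludes exactly the zeros of the product. *)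

theory Defs
  imports
    "HOL-Analysis.Analysis"
    "HOL-Computational_Algebra.Computational_Algebra"
begin

text \<open>
  The field \<open>K\<^sub>\<infinity> = F\<^sub>q((1/\<theta>))\<close> is the type \<open>'a fls\<close> of formal Laurent series over the
  finite field \<open>'a\<close>. The formal variable \<^const>\<open>fls_X\<close> plays the role of \<open>1/\<theta>\<close>.
\<close>

definition fls_theta :: "'a::finite_field fls"
  where "fls_theta = fls_X_inv"

definition poly_theta :: "'a::finite_field poly \<Rightarrow> 'a fls"
  where "poly_theta P = poly (map_poly fls_const P) fls_theta"

text \<open>The subfield \<open>K = F\<^sub>q(\<theta>)\<close> of \<open>K\<^sub>\<infinity>\<close>.\<close>

definition rational_functions :: "'a::finite_field fls set"
  where "rational_functions = {poly_theta P / poly_theta Q | P Q. Q \<noteq> 0}"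

definition fls_abs :: "'a::finite_field fls \<Rightarrow> real"
  where "fls_abs f = (if f = 0 then 0 else real CARD('a) powi (- fls_subdegree f))"

text \<open>
  Algebraicity over a subset \<open>k\<close> (in practice a subfield) of a field; the library predicate
  \<open>algebraic\<close> covers only algebraicity over the rationals.
\<close>

definition algebraic_over :: "'c::field set \<Rightarrow> 'c \<Rightarrow> bool"
  where "algebraic_over k x \<longleftrightarrow> (\<exists>P. P \<noteq> 0 \<and> (\<forall>i. coeff P i \<in> k) \<and> poly P x = 0)"

abbreviation transcendental_over :: "'c::field set \<Rightarrow> 'c \<Rightarrow> bool"
  where "transcendental_over k x \<equiv> \<not> algebraic_over k x"

definition is_subfield :: "'c::field set \<Rightarrow> bool"
  where "is_subfield L \<longleftrightarrow> 1 \<in> L \<and> (\<forall>x\<in>L. \<forall>y\<in>L. x - y \<in> L \<and> x * y \<in> L) \<and> (\<forall>x\<in>L. inverse x \<in> L)"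

definition is_algebraic_closure :: "'c::field set \<Rightarrow> 'c set \<Rightarrow> bool"
  where "is_algebraic_closure k L \<longleftrightarrow>
    is_subfield L \<and> k \<subseteq> L \<and> (\<forall>x\<in>L. algebraic_over k x) \<and>
    (\<forall>P. degree P > 0 \<and> (\<forall>i. coeff P i \<in> L) \<longrightarrow> (\<exists>x\<in>L. poly P x = 0))"

text \<open>
  The type \<open>'c\<close> with the embedding \<open>emb\<close> of \<open>K\<^sub>\<infinity>\<close> and the absolute value \<open>absv\<close> is a completion
  of the algebraic closure \<open>Kbar\<close> of \<open>K\<^sub>\<infinity>\<close>: it is complete (by its type class) for the metric
  induced by an absolute value that extends the one of \<open>K\<^sub>\<infinity>\<close>, and \<open>Kbar\<close> is dense in it. These
  conditions determine \<open>'c\<close> up to isometric isomorphism over \<open>K\<^sub>\<infinity>\<close>.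
\<close>

locale completed_algebraic_closure =
  fixes emb :: "'a::finite_field fls \<Rightarrow> 'c::{field, complete_space}"
    and absv :: "'c \<Rightarrow> real"
    and Kbar :: "'c set"
  assumes emb_1: "emb 1 = 1"
    and emb_add: "emb (f + g) = emb f + emb g"
    and emb_mult: "emb (f * g) = emb f * emb g"
    and absv_nonneg: "absv x \<ge> 0"
    and absv_eq_0_iff: "absv x = 0 \<longleftrightarrow> x = 0"
    and absv_mult: "absv (x * y) = absv x * absv y"
    and absv_add_le_max: "absv (x + y) \<le> max (absv x) (absv y)"
    and absv_emb: "absv (emb f) = fls_abs f"
    and dist_eq_absv: "dist x y = absv (x - y)"
    and algebraic_closure: "is_algebraic_closure (range emb) Kbar"
    and dense: "closure Kbar = UNIV"

definition theta :: "('a::finite_field fls \<Rightarrow> 'c::field) \<Rightarrow> 'c"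
  where "theta emb = emb fls_theta"

definition base_K :: "('a::finite_field fls \<Rightarrow> 'c::field) \<Rightarrow> 'c set"
  where "base_K emb = emb ` rational_functions"

definition K_alg :: "('a::finite_field fls \<Rightarrow> 'c::field) \<Rightarrow> 'c set"
  where "K_alg emb = {x. algebraic_over (base_K emb) x}"

text \<open>The factors are indexed by \<open>n \<ge> 1\<close>, whereas \<^const>\<open>prodinf\<close> starts at \<open>0\<close>.\<close>

definition f_De_factor :: "('a::finite_field fls \<Rightarrow> 'c::field) \<Rightarrow> 'c \<Rightarrow> nat \<Rightarrow> 'c"
  where "f_De_factor emb x n = 1 - theta emb * x ^ (CARD('a) ^ Suc n)"

definition f_De :: "('a::finite_field fls \<Rightarrow> 'c::{field, complete_space}) \<Rightarrow> 'c \<Rightarrow> 'c"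
  where "f_De emb x = (\<Prod>n. f_De_factor emb x n)"

text \<open>On \<open>F\<^sub>q[\<theta>]\<close> the absolute value is \<open>q\<close> to the power of the degree in \<open>\<theta>\<close>.\<close>

unbundle fps_syntax

lemma poly_theta_nth:
  "poly_theta (P::'a::finite_field poly) $$ k = (if k \<le> 0 then coeff P (nat (-k)) else 0)"
proof (induction P arbitrary: k)
  case 0
  then show ?case by (simp add: poly_theta_def)
next
  case (pCons a P)
  have "poly_theta (pCons a P) = fls_const a + fls_X_inv * poly_theta P"
    by (simp add: poly_theta_def map_poly_pCons fls_theta_def)
  hence "poly_theta (pCons a P) $$ k = (if k = 0 then a else 0) + poly_theta P $$ (k+1)"
    by (simp add: fls_X_inv_times_conv_shift)
  also have "\<dots> = (if k \<le> 0 then coeff (pCons a P) (nat (-k)) else 0)"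
  proof -
    consider "k = 0" | "k > 0" | "k < 0" by linarith
    thus ?thesis
    proof cases
      case 3
      then have "nat (-k) = Suc (nat (- (k+1)))" by simp
      with 3 show ?thesis by (simp add: pCons.IH del: minus_add_distrib)
    qed (auto simp: pCons.IH)
  qed
  finally show ?case .
qed

lemma fls_abs_poly_theta:
  assumes "(P::'a::finite_field poly) \<noteq> 0"
  shows "fls_abs (poly_theta P) = real CARD('a) ^ degree P"
proof -
  have "fls_subdegree (poly_theta P) = - int (degree P)"
    by (intro fls_subdegree_eqI)
       (use assms in \<open>auto simp: poly_theta_nth coeff_eq_0\<close>)
  moreover have "poly_theta P \<noteq> 0"
    using assms poly_theta_nth[of P "- int (degree P)"] by auto
  ultimately show ?thesis by (simp add: fls_abs_def)
qed

unbundle no fps_syntax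

lemma fls_theta_nonzero: "fls_theta \<noteq> 0"
  by (simp add: fls_theta_def)

lemma rational_functionsI: "Q \<noteq> 0 \<Longrightarrow> poly_theta P / poly_theta Q \<in> rational_functions"
  unfolding rational_functions_def by blast

context completed_algebraic_closure begin

lemma emb_0: "emb 0 = 0"
  using emb_add[of 0 0] by (metis add_cancel_right_left)

lemma absv_theta: "absv (theta emb) = real CARD('a)"
  by (simp add: theta_def absv_emb fls_abs_def fls_theta_def)

lemma card_gt1: "CARD('a) > 1"
proof -
  have "card {0, 1::'a} \<le> CARD('a)" by (intro card_mono) auto
  thus ?thesis by simp
qed

lemma absv_1: "absv 1 = 1"
  using absv_mult[of 1 1] absv_eq_0_iff[of 1] by simp

lemma absv_power: "absv (x ^ n) = absv x ^ n"
  by (induction n) (auto simp: absv_1 absv_mult)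

lemma absv_minus: "absv (- x) = absv x"
  using dist_eq_absv[of 0 x] dist_eq_absv[of x 0] by (simp add: dist_commute)

lemma summand_tendsto_0:
  assumes "absv x < 1"
  shows "(\<lambda>n. absv (theta emb * x ^ (CARD('a) ^ Suc n))) \<longlonglongrightarrow> 0"
proof -
  have "(\<lambda>n. absv x ^ n) \<longlonglongrightarrow> 0"
    using assms absv_nonneg by (intro LIMSEQ_realpow_zero) auto
  moreover have "strict_mono (\<lambda>n. CARD('a) ^ Suc n)"
    using card_gt1 by (intro strict_monoI power_strict_increasing) auto
  ultimately have "(\<lambda>n. absv x ^ (CARD('a) ^ Suc n)) \<longlonglongrightarrow> 0"
    by (rule LIMSEQ_subseq_LIMSEQ[unfolded o_def])
  from tendsto_mult_left[OF this, of "absv (theta emb)"] show ?thesis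
    by (simp add: absv_mult absv_power)
qed

lemma absv_1_minus: assumes "absv y < 1" shows "absv (1 - y) = 1"
proof (rule antisym)
  show "absv (1 - y) \<le> 1" using absv_add_le_max[of 1 "-y"] assms by (simp add: absv_minus absv_1)
  show "absv (1 - y) \<ge> 1" using absv_add_le_max[of "1 - y" "y"] assms by (simp add: absv_1)
qed

lemma dist_seq_le:
  fixes X :: "nat \<Rightarrow> 'c"
  assumes "\<And>n. n \<ge> N \<Longrightarrow> dist (X (Suc n)) (X n) < e" "m \<ge> N" "e > 0"
  shows "dist (X (m + k)) (X m) < e"
proof (induction k)
  case 0 then show ?case using assms by simp
next
  case (Suc k)
  have "dist (X (m + Suc k)) (X m) = absv ((X (Suc (m+k)) - X (m+k)) + (X (m+k) - X m))"
    by (simp add: dist_eq_absv)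
  also have "\<dots> \<le> max (dist (X (Suc (m+k))) (X (m+k))) (dist (X (m+k)) (X m))"
    unfolding dist_eq_absv by (rule absv_add_le_max)
  also have "\<dots> < e" using Suc assms(1)[of "m+k"] assms(2) by simp
  finally show ?case .
qed

lemma raw_has_prod_tail:
  assumes x: "absv x < 1" and N: "\<And>n. n \<ge> M \<Longrightarrow> absv (theta emb * x ^ (CARD('a) ^ Suc n)) < 1"
  shows "\<exists>p. raw_has_prod (f_De_factor emb x) M p"
proof -
  define s where "s n = theta emb * x ^ (CARD('a) ^ Suc n)" for n
  have s0: "(\<lambda>n. absv (s n)) \<longlonglongrightarrow> 0" using summand_tendsto_0[OF x] by (simp add: s_def)
  note N = N[folded s_def]
    define P where "P n = (\<Prod>i\<le>n. f_De_factor emb x (i + M))" for n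
    have P1: "absv (P n) = 1" for n
    proof (induction n)
      case 0 then show ?case using N[of M] by (simp add: P_def f_De_factor_def absv_1_minus s_def)
    next
      case (Suc n)
      have "P (Suc n) = P n * (1 - s (Suc n + M))" by (simp add: P_def f_De_factor_def s_def)
      then show ?case using Suc N[of "Suc n + M"] by (simp add: absv_mult absv_1_minus)
    qed
    have d: "dist (P (Suc n)) (P n) = absv (s (Suc n + M))" for n
    proof -
      have "P (Suc n) - P n = - (P n * s (Suc n + M))"
        by (simp add: P_def f_De_factor_def s_def algebra_simps)
      thus ?thesis by (simp add: dist_eq_absv absv_minus absv_mult P1)
    qed
    have "Cauchy P"
    proof (rule metric_CauchyI)
      fix e :: real assume e: "e > 0"
      then obtain L where L: "\<And>n. n \<ge> L \<Longrightarrow> absv (s n) < e"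
        using order_tendstoD(2)[OF s0, of e] by (auto simp: eventually_sequentially)
      have st: "dist (P (Suc n)) (P n) < e" if "n \<ge> L" for n using d L that by simp
      have *: "dist (P (m + k)) (P m) < e" if "m \<ge> L" for m k
        using dist_seq_le[of L P e m k] st that e by blast
      have "dist (P m) (P n) < e" if "m \<ge> L" "n \<ge> L" for m n
      proof (cases "m \<le> n")
        case True
        then show ?thesis using *[of m "n - m"] that by (simp add: dist_commute)
      next
        case False
        then show ?thesis using *[of n "m - n"] that by simp
      qed
      thus "\<exists>L. \<forall>m\<ge>L. \<forall>n\<ge>L. dist (P m) (P n) < e" by blast
    qed
    then obtain p where p: "P \<longlonglongrightarrow> p" using Cauchy_convergent convergent_def by blast
    have "(\<lambda>n. dist (P n) 0) \<longlonglongrightarrow> dist p 0" by (intro tendsto_intros p)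
    hence "p \<noteq> 0" using absv_eq_0_iff[of 0] by (auto simp: dist_eq_absv P1 LIMSEQ_const_iff)
    with p show "\<exists>p. raw_has_prod (f_De_factor emb x) M p"
      unfolding raw_has_prod_def P_def by blast
qed

lemma eventually_small:
  assumes x: "absv x < 1"
  obtains M where "\<And>n. n \<ge> M \<Longrightarrow> absv (theta emb * x ^ (CARD('a) ^ Suc n)) < 1"
  using order_tendstoD(2)[OF summand_tendsto_0[OF x], of 1]
  unfolding eventually_sequentially by (metis zero_less_one)

lemma convergent_prod_f_De:
  assumes "absv x < 1" shows "convergent_prod (f_De_factor emb x)"
proof -
  obtain M where "\<And>n. n \<ge> M \<Longrightarrow> absv (theta emb * x ^ (CARD('a) ^ Suc n)) < 1"
    using eventually_small[OF assms] by blast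
  from raw_has_prod_tail[OF assms this] show ?thesis
    unfolding convergent_prod_def by blast
qed

lemma tendsto_cmult:
  fixes X :: "nat \<Rightarrow> 'c"
  assumes "X \<longlonglongrightarrow> p" shows "(\<lambda>n. c * X n) \<longlonglongrightarrow> c * p"
proof -
  have "(\<lambda>n. absv c * dist (X n) p) \<longlonglongrightarrow> absv c * dist p p"
    by (intro tendsto_intros assms)
  moreover have "absv c * dist (X n) p = dist (c * X n) (c * p)" for n
    by (simp add: dist_eq_absv absv_mult flip: right_diff_distrib)
  ultimately show ?thesis by (subst tendsto_dist_iff) simp
qed

lemma has_prod_0_f_De:
  assumes x: "absv x < 1" and n: "theta emb * x ^ (CARD('a) ^ Suc n) = 1"
  shows "f_De_factor emb x has_prod 0"
proof -
  let ?q = "CARD('a)"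
  have "absv (theta emb * x ^ (?q ^ Suc m)) < 1" if "m \<ge> Suc n" for m
  proof -
    have "x \<noteq> 0" using n by (auto simp: power_0_left)
    hence "absv x > 0" using absv_nonneg[of x] absv_eq_0_iff[of x] by linarith
    moreover have "?q ^ Suc n < ?q ^ Suc m"
      using card_gt1 that by (intro power_strict_increasing) auto
    ultimately have "absv x ^ (?q ^ Suc m) < absv x ^ (?q ^ Suc n)"
      using power_strict_decreasing[of "?q ^ Suc n" "?q ^ Suc m" "absv x"] x by blast
    moreover have "absv (theta emb) > 0"
      unfolding absv_theta using card_gt1 by simp
    ultimately have "absv (theta emb) * absv x ^ (?q ^ Suc m) < absv (theta emb) * absv x ^ (?q ^ Suc n)"
      by (intro mult_strict_left_mono)
    also have "\<dots> = 1"
      by (metis n absv_1 absv_mult absv_power)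
    finally show ?thesis by (simp only: absv_mult absv_power)
  qed
  from raw_has_prod_tail[OF x this] obtain p where "raw_has_prod (f_De_factor emb x) (Suc n) p"
    by blast
  moreover have "f_De_factor emb x n = 0" by (simp only: f_De_factor_def n) simp
  ultimately show ?thesis unfolding has_prod_def by blast
qed

lemma has_prod_f_De:
  assumes x: "absv x < 1"
  shows "f_De_factor emb x has_prod f_De emb x"
proof -
  let ?f = "f_De_factor emb x"
  have "\<exists>p. ?f has_prod p"
  proof (cases "\<exists>n. ?f n = 0")
    case True
    thus ?thesis using has_prod_0_f_De[OF x] by (force simp: f_De_factor_def)
  next
    case False
    obtain M p where p: "raw_has_prod ?f M p"
      using convergent_prod_f_De[OF x] unfolding convergent_prod_def by blast
    let ?c = "\<Prod>i<M. ?f i"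
    have eq: "(\<Prod>i\<le>n + M. ?f i) = ?c * (\<Prod>i\<le>n. ?f (i + M))" for n
    proof (induction n)
      case 0
      show ?case by (simp add: lessThan_Suc_atMost[symmetric])
    next
      case (Suc n)
      then show ?case by (simp add: mult.assoc)
    qed
    have "(\<lambda>n. \<Prod>i\<le>n + M. ?f i) \<longlonglongrightarrow> ?c * p"
      unfolding eq by (intro tendsto_cmult) (use p in \<open>simp add: raw_has_prod_def\<close>)
    hence "(\<lambda>n. \<Prod>i\<le>n. ?f i) \<longlonglongrightarrow> ?c * p" by (rule LIMSEQ_offset)
    moreover have "?c * p \<noteq> 0" using p False by (auto simp: raw_has_prod_def)
    ultimately have "raw_has_prod ?f 0 (?c * p)" by (simp add: raw_has_prod_def)
    thus ?thesis by (auto simp: has_prod_def)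
  qed
  thus ?thesis unfolding f_De_def using has_prod_unique by metis
qed

text \<open>
  The product has zeros in the punctured open unit disc: if \<open>x^(q^n) = 1/\<theta>\<close> for some \<open>n \<ge> 1\<close>,
  then the \<open>n\<close>-th factor vanishes at \<open>x\<close>. Such points are algebraic over \<open>K\<close>, so they have to be
  excluded from any statement about the transcendence of the values of the product.
\<close>

lemma f_De_eq_0:
  assumes x: "absv x < 1" and n: "n \<ge> 1" "theta emb * x ^ (CARD('a) ^ n) = 1"
  shows "f_De emb x = 0"
  using has_prod_0_f_De[OF x, of "n - 1"] has_prod_f_De[OF x] n
  by (simp add: has_prod_unique2)

lemma K_0: "0 \<in> base_K emb" and K_1: "1 \<in> base_K emb" and K_inverse_theta: "inverse (theta emb) \<in> base_K emb"
proof -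
  have "poly_theta 0 / poly_theta 1 \<in> (rational_functions :: 'a fls set)"
    by (intro rational_functionsI) simp
  thus "0 \<in> base_K emb" by (force simp: base_K_def poly_theta_def emb_0)
  have "poly_theta 1 / poly_theta 1 \<in> (rational_functions :: 'a fls set)"
    by (intro rational_functionsI) simp
  thus "1 \<in> base_K emb" by (force simp: base_K_def poly_theta_def emb_1 map_poly_1')
  have "poly_theta 1 / poly_theta [:0, 1:] \<in> (rational_functions :: 'a fls set)"
    by (intro rational_functionsI) simp
  hence mem: "inverse fls_theta \<in> (rational_functions :: 'a fls set)"
    by (simp add: poly_theta_def map_poly_1' map_poly_pCons field_simps)
  have "fls_theta * inverse (fls_theta :: 'a fls) = 1"
    using fls_theta_nonzero by (rule right_inverse)
  hence "theta emb * emb (inverse fls_theta) = 1"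
    by (metis emb_1 emb_mult theta_def)
  hence "emb (inverse fls_theta) = inverse (theta emb)"
    by (metis inverse_unique)
  with mem show "inverse (theta emb) \<in> base_K emb" by (force simp: base_K_def)
qed

lemma exists_algebraic_zero:
  "\<exists>\<alpha>\<in>K_alg emb. 0 < absv \<alpha> \<and> absv \<alpha> < 1 \<and> algebraic_over (base_K emb) (f_De emb \<alpha>)"
proof -
  define q where "q = CARD('a)"
  have q: "q > 1" using card_gt1 by (simp add: q_def)
  have th: "theta emb \<noteq> 0" using absv_theta absv_eq_0_iff by (metis of_nat_0_less_iff less_irrefl finite_UNIV_card_ge_0 finite)
  define c where "c = inverse (theta emb)"
  define P where "P = monom 1 q + [:-c:]"
  have coeffP: "coeff P i = (if i = q then 1 else if i = 0 then -c else 0)" for i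
    using q by (auto simp: P_def coeff_pCons split: nat.splits)
  have "degree P = q"
    using q by (auto simp: P_def degree_add_eq_left degree_monom_eq)
  have KL: "base_K emb \<subseteq> Kbar" and sub: "is_subfield Kbar"
    using algebraic_closure by (auto simp: is_algebraic_closure_def base_K_def)
  have "0 - c \<in> Kbar" "0 \<in> Kbar" "1 \<in> Kbar"
    using KL sub K_0 K_1 K_inverse_theta unfolding is_subfield_def c_def by blast+
  hence "\<forall>i. coeff P i \<in> Kbar" by (simp add: coeffP)
  with \<open>degree P = q\<close> q obtain a where "poly P a = 0"
    using algebraic_closure unfolding is_algebraic_closure_def by (metis less_trans zero_less_one)
  hence aq: "a ^ q = c" by (simp add: P_def poly_monom)
  hence one: "theta emb * a ^ (CARD('a) ^ 1) = 1" using th by (simp add: c_def q_def)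
  hence "real q * absv a ^ q = 1"
    by (metis absv_1 absv_mult absv_power absv_theta power_one_right q_def)
  hence aa: "absv a ^ q = 1 / real q" using q by (simp add: field_simps)
  have "absv a \<noteq> 0" using aa q by (auto simp: power_0_left)
  hence "absv a > 0" using absv_nonneg[of a] by linarith
  moreover have "absv a < 1"
  proof (rule ccontr)
    assume "\<not> absv a < 1"
    hence "absv a ^ q \<ge> 1" by simp
    with aa q show False by simp
  qed
  moreover have "a \<in> K_alg emb"
  proof -
    have K_minus: "- c \<in> base_K emb"
    proof -
      have "poly_theta (-1) / poly_theta [:0, 1:] \<in> (rational_functions :: 'a fls set)"
        by (intro rational_functionsI) simp
      hence mem: "- inverse fls_theta \<in> (rational_functions :: 'a fls set)"
        by (simp add: poly_theta_def map_poly_pCons field_simps one_pCons)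
      have "emb (- inverse fls_theta) + emb (inverse fls_theta) = 0"
        by (simp flip: emb_add add: emb_0)
      moreover have "theta emb * emb (inverse fls_theta) = 1"
        by (simp flip: emb_mult add: theta_def emb_1 fls_theta_nonzero)
      ultimately have "emb (- inverse fls_theta) = - c"
        by (metis c_def inverse_unique eq_neg_iff_add_eq_0)
      with mem show ?thesis by (force simp: base_K_def)
    qed
    have "P \<noteq> 0" using \<open>degree P = q\<close> q by auto
    moreover have "\<forall>i. coeff P i \<in> base_K emb"
      using K_minus K_0 K_1 by (simp add: coeffP)
    ultimately show ?thesis
      using \<open>poly P a = 0\<close> unfolding K_alg_def algebraic_over_def by blast
  qed
  moreover have "f_De emb a = 0" using f_De_eq_0[OF \<open>absv a < 1\<close> _ one] by simp
  moreover have "algebraic_over (base_K emb) 0"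
    unfolding algebraic_over_def
    by (rule exI[of _ "[:0, 1:]"]) (use K_0 K_1 in \<open>auto simp: coeff_pCons split: nat.splits\<close>)
  ultimately show ?thesis by metis
qed

end

end

theory Submission
  imports Defs
begin

text \<open>
  Mahler's method. Let \<open>F\<close> be the power series of the product, so \<open>F(x) = (1 - \<theta> x^q) F(x^q)\<close>, and
  choose a nonzero \<open>P(x, y)\<close> over \<open>F\<^sub>q[\<theta>]\<close> of degree at most \<open>N\<close> in \<open>x\<close> and in \<open>y\<close> such that
  \<open>P(x, F(x))\<close> vanishes at \<open>0\<close> to order at least \<open>N\<^sup>2\<close>. Since \<open>F\<close> is transcendental over the rational
  functions, \<open>P(x, F(x))\<close> is not zero, so its values at \<open>\<alpha>^(q^n)\<close> are eventually nonzero, of absolute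
  value at most a constant times \<open>|\<alpha>|^(N\<^sup>2 q^n)\<close>. If \<open>f(\<alpha>)\<close> were algebraic, the functional equation
  would turn them, up to bounded factors, into polynomial expressions in \<open>\<theta>\<close>, \<open>\<alpha>\<close>, \<open>f(\<alpha>)\<close> of degree
  \<open>O(N q^n)\<close>, and a Liouville inequality bounds those below by \<open>exp(-O(N q^n))\<close>. For large \<open>N\<close> and then
  large \<open>n\<close> the two bounds are incompatible.
\<close>

section \<open>Small solutions of linear systems over \<open>F\<^sub>q[\<theta>]\<close>\<close>

text \<open>Bounding the size by vanishing coefficients instead of the degree makes
  \<open>T = 0\<close> the zero space, so that the count is exactly
  \<open>CARD('a) ^ T\<close>.\<close>

lemma
  shows finite_polys_coeff_0_ge: "finite {p::'a::finite_field poly. \<forall>i\<ge>T. coeff p i = 0}" (is "finite (?S T)")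
    and card_polys_coeff_0_ge: "card {p::'a::finite_field poly. \<forall>i\<ge>T. coeff p i = 0} = CARD('a) ^ T"
proof (induction T)
  case 0
  have "?S 0 = {0}" by (auto simp: poly_eq_iff)
  then show "finite (?S 0)" "card (?S 0) = CARD('a) ^ 0" by simp_all
next
  case (Suc T)
  have eq: "?S (Suc T) = (\<lambda>(a, p). pCons a p) ` (UNIV \<times> ?S T)" (is "_ = ?R")
  proof (intro equalityI subsetI)
    fix p assume p: "p \<in> ?S (Suc T)"
    obtain a r where [simp]: "p = pCons a r" by (cases p)
    have "coeff r i = 0" if "i \<ge> T" for i
      using p that by (auto dest: spec[of _ "Suc i"])
    thus "p \<in> ?R" by auto
  qed (auto simp: coeff_pCons split: nat.splits)
  have inj: "inj_on (\<lambda>(a, p). pCons a p) (UNIV \<times> ?S T)" by (auto simp: inj_on_def)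
  show "finite (?S (Suc T))" unfolding eq using Suc by simp
  show "card (?S (Suc T)) = CARD('a) ^ Suc T"
    unfolding eq using Suc by (subst card_image[OF inj]) (simp add: card_cartesian_product)
qed

text \<open>Pigeonhole: the vectors of polynomials of degree at most \<open>E * card J\<close>
  outnumber their possible images under the system, so two of them have the same image. Their
  difference is a solution, and subtraction does not raise degrees.\<close>

lemma siegel:
  fixes m :: "'l \<Rightarrow> 'j \<Rightarrow> 'a::finite_field poly"
  assumes L: "finite L" and J: "finite J" and less: "card J < card L"
    and deg: "\<And>l j. l \<in> L \<Longrightarrow> j \<in> J \<Longrightarrow> degree (m l j) \<le> E"
  obtains c where "\<exists>l\<in>L. c l \<noteq> 0" "\<And>l. degree (c l) \<le> E * card J"
    "\<And>j. j \<in> J \<Longrightarrow> (\<Sum>l\<in>L. c l * m l j) = 0"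
proof -
  define S where "S n = {p::'a poly. \<forall>i\<ge>n. coeff p i = 0}" for n
  \<comment> \<open>The least number above \<open>E * card J\<close>, which makes
    \<open>(T + E) * card J\<close> smaller than \<open>T * (card J + 1)\<close>.\<close>
  define T where "T = E * card J + 1"
  have S: "finite (S n)" "card (S n) = CARD('a) ^ n" for n
    unfolding S_def by (rule finite_polys_coeff_0_ge, rule card_polys_coeff_0_ge)
  define X where "X = PiE L (\<lambda>_. S T)"
  define Y where "Y = PiE J (\<lambda>_. S (T + E))"
  define \<phi> where "\<phi> c = restrict (\<lambda>j. \<Sum>l\<in>L. c l * m l j) J" for c
  have q: "CARD('a) > 1"
  proof -
    have "card {0, 1::'a} \<le> CARD('a)" by (intro card_mono) auto
    thus ?thesis by simp
  qed
  have "\<phi> c \<in> Y" if "c \<in> X" for c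
  proof -
    have "c l * m l j \<in> S (T + E)" if "l \<in> L" "j \<in> J" for l j
    proof -
      have "c l \<in> S T" using \<open>c \<in> X\<close> \<open>l \<in> L\<close> by (auto simp: X_def)
      hence "coeff (c l) i * coeff (m l j) (n - i) = 0" if "n \<ge> T + E" "i \<le> n" for n i
        using deg[OF \<open>l \<in> L\<close> \<open>j \<in> J\<close>] that
        by (cases "i \<ge> T") (auto simp: S_def intro!: coeff_eq_0)
      thus ?thesis by (auto simp: S_def coeff_mult intro!: sum.neutral)
    qed
    thus ?thesis by (auto simp: Y_def \<phi>_def S_def coeff_sum intro!: sum.neutral)
  qed
  hence "card (\<phi> ` X) \<le> card Y"
    using S J by (intro card_mono) (auto simp: Y_def intro!: finite_PiE)
  also have "card Y = CARD('a) ^ ((T + E) * card J)"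
    using J S by (simp add: Y_def card_PiE power_mult)
  also have "\<dots> < CARD('a) ^ (T * card L)"
  proof (rule power_strict_increasing[OF _ q])
    have "(T + E) * card J < T * (card J + 1)" by (simp add: T_def algebra_simps)
    also have "\<dots> \<le> T * card L" using less by (intro mult_left_mono) auto
    finally show "(T + E) * card J < T * card L" .
  qed
  also have "\<dots> = card X"
    using L S by (simp add: X_def card_PiE power_mult)
  finally have "\<not> inj_on \<phi> X" by (rule pigeonhole)
  then obtain c1 c2 where c: "c1 \<in> X" "c2 \<in> X" "c1 \<noteq> c2" "\<phi> c1 = \<phi> c2" by (auto simp: inj_on_def)
  \<comment> \<open>The value 0 outside \<open>L\<close> makes the degree bound hold for every
    \<open>l\<close>.\<close>
  define c where "c l = (if l \<in> L then c1 l - c2 l else 0)" for l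
  have "\<exists>l\<in>L. c l \<noteq> 0"
    using c unfolding c_def X_def by (metis PiE_ext right_minus_eq)
  moreover have "degree (c l) \<le> E * card J" for l
    using c(1,2) by (intro degree_le) (auto simp: c_def X_def S_def T_def dest!: PiE_mem)
  moreover have "(\<Sum>l\<in>L. c l * m l j) = 0" if "j \<in> J" for j
  proof -
    have "(\<Sum>l\<in>L. c1 l * m l j) = (\<Sum>l\<in>L. c2 l * m l j)"
      using fun_cong[OF c(4), of j] that by (simp add: \<phi>_def)
    thus ?thesis by (simp add: c_def left_diff_distrib sum_subtractf)
  qed
  ultimately show ?thesis by (rule that)
qed

section \<open>A Liouville inequality\<close>

lemma poly_theta_simps:
  shows poly_theta_0: "poly_theta (0::'a::finite_field poly) = 0"
    and poly_theta_1: "poly_theta (1::'a poly) = 1"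
    and poly_theta_pCons: "poly_theta (pCons c (P::'a poly)) = fls_const c + fls_theta * poly_theta P"
  by (simp_all add: poly_theta_def map_poly_1' map_poly_pCons)

lemma poly_theta_add: "poly_theta (P + Q) = poly_theta P + poly_theta (Q :: 'a::finite_field poly)"
  by (induction P Q rule: poly_induct2)
     (simp_all add: poly_theta_simps algebra_simps flip: fls_plus_const)

lemma poly_theta_smult: "poly_theta (smult c P) = fls_const c * poly_theta (P :: 'a::finite_field poly)"
  by (induction P) (simp_all add: poly_theta_simps algebra_simps flip: fls_const_mult_const)

lemma poly_theta_mult: "poly_theta (P * Q) = poly_theta P * poly_theta (Q :: 'a::finite_field poly)"
proof (induction P)
  case (pCons c P)
  have "poly_theta (pCons c P * Q) = poly_theta (smult c Q) + poly_theta (pCons 0 (P * Q))"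
    by (simp add: poly_theta_add)
  thus ?case by (simp add: pCons.IH poly_theta_smult poly_theta_pCons algebra_simps)
qed (simp add: poly_theta_0)

context completed_algebraic_closure
begin

text \<open>This copy of F_q[\<theta>] plays the role of the integers: its nonzero elements have
  absolute value at least 1, from which the Liouville inequality starts.\<close>

definition \<iota> :: "'a poly \<Rightarrow> 'c"
  where "\<iota> P = emb (poly_theta P)"

lemma \<iota>_0 [simp]: "\<iota> 0 = 0" and \<iota>_1 [simp]: "\<iota> 1 = 1"
  by (simp_all add: \<iota>_def poly_theta_0 poly_theta_1 emb_0 emb_1)

lemma \<iota>_add: "\<iota> (P + Q) = \<iota> P + \<iota> Q" and \<iota>_mult: "\<iota> (P * Q) = \<iota> P * \<iota> Q"
  by (simp_all add: \<iota>_def poly_theta_add poly_theta_mult emb_add emb_mult)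

lemma \<iota>_minus: "\<iota> (- P) = - \<iota> P"
  using \<iota>_add[of P "- P"] by (simp add: minus_unique)

lemma \<iota>_power: "\<iota> (P ^ n) = \<iota> P ^ n"
  by (induction n) (simp_all add: \<iota>_mult)

lemma \<iota>_sum: "\<iota> (\<Sum>i\<in>A. f i) = (\<Sum>i\<in>A. \<iota> (f i))"
  by (induction A rule: infinite_finite_induct) (simp_all add: \<iota>_add)

lemma \<iota>_theta: "\<iota> [:0, 1:] = theta emb"
  by (simp add: \<iota>_def theta_def poly_theta_pCons poly_theta_0)

lemma absv_\<iota>: "P \<noteq> 0 \<Longrightarrow> absv (\<iota> P) = real CARD('a) ^ degree P"
  by (simp add: \<iota>_def absv_emb fls_abs_poly_theta)

lemma absv_0: "absv 0 = 0"
  using absv_eq_0_iff[of 0] by simp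

lemma absv_\<iota>_ge_1: "P \<noteq> 0 \<Longrightarrow> absv (\<iota> P) \<ge> 1"
  using card_gt1 by (simp add: absv_\<iota>)

lemma absv_\<iota>_le: "degree P \<le> n \<Longrightarrow> absv (\<iota> P) \<le> real CARD('a) ^ n"
  using card_gt1 by (cases "P = 0") (simp_all add: absv_\<iota> absv_0 power_increasing)

lemma \<iota>_eq_0_iff [simp]: "\<iota> P = 0 \<longleftrightarrow> P = 0"
  using absv_\<iota>_ge_1[of P] absv_0 by force

lemma absv_sum_le:
  assumes "\<And>i. i \<in> A \<Longrightarrow> absv (f i) \<le> B" "B \<ge> 0"
  shows "absv (\<Sum>i\<in>A. f i) \<le> B"
  using assms
proof (induction A rule: infinite_finite_induct)
  case (insert i A)
  have "absv (f i + sum f A) \<le> max (absv (f i)) (absv (sum f A))" by (rule absv_add_le_max)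
  moreover have "absv (f i) \<le> B" "absv (sum f A) \<le> B" using insert by simp_all
  ultimately show ?case using insert(1,2) by simp
qed (simp_all add: absv_0)

lemma absv_diff_le_max: "absv (x - y) \<le> max (absv x) (absv y)"
  using absv_add_le_max[of x "- y"] by (simp add: absv_minus)

lemma absv_add_eq: "absv y < absv x \<Longrightarrow> absv (x + y) = absv x"
  using absv_add_le_max[of x y] absv_diff_le_max[of "x + y" y] by simp

lemma absv_pos_iff: "absv x > 0 \<longleftrightarrow> x \<noteq> 0"
  using absv_nonneg[of x] absv_eq_0_iff[of x] by linarith

section \<open>Reduction of the powers of an algebraic element\<close>

lemma base_K_eq: "base_K emb = {\<iota> P / \<iota> Q | P Q. Q \<noteq> 0}"
proof -
  have "emb (poly_theta P / poly_theta Q) = \<iota> P / \<iota> Q" if "Q \<noteq> 0" for P Q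
  proof -
    have "poly_theta Q \<noteq> 0" using that \<iota>_eq_0_iff[of Q] by (auto simp: \<iota>_def emb_0)
    hence "emb (poly_theta P / poly_theta Q) * \<iota> Q = \<iota> P"
      by (simp add: \<iota>_def flip: emb_mult)
    thus ?thesis using that by (simp add: field_simps)
  qed
  thus ?thesis unfolding base_K_def rational_functions_def by (force simp: image_iff)
qed

text \<open>Denominators are cleared and the relation is solved for its leading term, so that it can
  serve as a rewriting rule for \<open>x ^ d\<close>.\<close>

lemma algebraic_over_base_KE:
  assumes "algebraic_over (base_K emb) x"
  obtains A d where "A d \<noteq> 0" "\<iota> (A d) * x ^ d = (\<Sum>i<d. \<iota> (A i) * x ^ i)"
proof -
  obtain P where P: "P \<noteq> 0" "\<And>i. coeff P i \<in> base_K emb" "poly P x = 0"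
    using assms unfolding algebraic_over_def by blast
  from P(2) have "\<forall>i. \<exists>N D. coeff P i = \<iota> N / \<iota> D \<and> D \<noteq> 0"
    unfolding base_K_eq by blast
  then obtain N D where ND: "\<And>i. coeff P i = \<iota> (N i) / \<iota> (D i)" "\<And>i. D i \<noteq> 0" by metis
  define d where "d = degree P"
  define B where "B i = N i * (\<Prod>j\<in>{..d} - {i}. D j)" for i
  have B: "\<iota> (B i) = \<iota> (\<Prod>j\<le>d. D j) * coeff P i" if "i \<le> d" for i
    using that ND(2)[of i] by (simp add: B_def \<iota>_mult ND(1) prod.remove[of "{..d}" i D])
  have "(\<Sum>i\<le>d. \<iota> (B i) * x ^ i) = \<iota> (\<Prod>j\<le>d. D j) * poly P x"
    by (simp add: B poly_altdef d_def sum_distrib_left mult.assoc)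
  hence "\<iota> (B d) * x ^ d = - (\<Sum>i<d. \<iota> (B i) * x ^ i)"
    by (simp add: P(3) lessThan_Suc_atMost[symmetric] eq_neg_iff_add_eq_0 add.commute)
  moreover have "B d \<noteq> 0"
  proof -
    have "N d \<noteq> 0" using P(1) ND(1)[of d] by (auto simp: d_def)
    thus ?thesis using ND(2) by (simp add: B_def)
  qed
  ultimately show ?thesis
    by (intro that[of "\<lambda>i. if i = d then B d else - B i" d]) (simp_all add: \<iota>_minus sum_negf)
qed

text \<open>Each factor \<open>\<iota> a\<close>, the leading coefficient, pays for one replacement
  of \<open>x ^ d\<close> by lower powers, which costs at most \<open>h\<close> in degree.
  Separating \<open>M\<close> from \<open>n\<close> gives all powers up to \<open>M\<close> the same
  denominator.\<close>

lemma algebraic_power_reduction: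
  assumes "algebraic_over (base_K emb) x"
  obtains a d h where "a \<noteq> 0"
    "\<And>n M. n \<le> M \<Longrightarrow> \<exists>c. (\<forall>i. degree (c i) \<le> h * M) \<and> \<iota> a ^ M * x ^ n = (\<Sum>i<d. \<iota> (c i) * x ^ i)"
proof -
  obtain A d where A: "A d \<noteq> 0" "\<iota> (A d) * x ^ d = (\<Sum>i<d. \<iota> (A i) * x ^ i)"
    using algebraic_over_base_KE[OF assms] by blast
  define h where "h = Max ((\<lambda>i. degree (A i)) ` {..d})"
  have h: "degree (A i) \<le> h" if "i \<le> d" for i using that unfolding h_def by (intro Max_ge) auto
  have "d > 0" using A by (cases d) auto
  have red: "\<exists>c. (\<forall>i. degree (c i) \<le> h * n) \<and> \<iota> (A d) ^ n * x ^ n = (\<Sum>i<d. \<iota> (c i) * x ^ i)" for n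
  proof (induction n)
    case 0
    have "(\<Sum>i<d. \<iota> (if i = 0 then 1 else 0) * x ^ i) = (\<Sum>i<d. if i = 0 then 1 else 0)"
      by (intro sum.cong) auto
    then show ?case using \<open>d > 0\<close> by (intro exI[of _ "\<lambda>i. if i = 0 then 1 else 0"]) simp
  next
    case (Suc n)
    then obtain c where c: "\<And>i. degree (c i) \<le> h * n"
      "\<iota> (A d) ^ n * x ^ n = (\<Sum>i<d. \<iota> (c i) * x ^ i)" by blast
    obtain e where d: "d = Suc e" using \<open>d > 0\<close> by (cases d) auto
    \<comment> \<open>Multiplication by \<open>\<iota> (A d) * x\<close> shifts the coefficients up,
      and the overflow at \<open>x ^ d\<close> is rewritten by the relation. The value 0 from
      \<open>d\<close> on keeps the degree bound valid for all \<open>i\<close>, since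
      \<open>h\<close> bounds only \<open>A 0\<close> to \<open>A d\<close>.\<close>
    define c' where "c' i = (if i < d then (if i = 0 then 0 else A d * c (i - 1)) + c e * A i else 0)" for i
    have "\<iota> (A d) ^ Suc n * x ^ Suc n = \<iota> (A d) * x * (\<Sum>i<d. \<iota> (c i) * x ^ i)"
      by (simp flip: c(2))
    also have "\<dots> = (\<Sum>i<e. \<iota> (A d * c i) * x ^ Suc i) + \<iota> (c e) * (\<iota> (A d) * x ^ d)"
      by (simp add: d sum_distrib_left \<iota>_mult algebra_simps)
    also have "(\<Sum>i<e. \<iota> (A d * c i) * x ^ Suc i) = (\<Sum>i<d. \<iota> (if i = 0 then 0 else A d * c (i - 1)) * x ^ i)"
      unfolding d by (subst sum.lessThan_Suc_shift) simp
    also have "\<dots> + \<iota> (c e) * (\<iota> (A d) * x ^ d) = (\<Sum>i<d. \<iota> (c' i) * x ^ i)"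
      unfolding A(2) sum_distrib_left sum.distrib[symmetric]
      by (intro sum.cong) (auto simp: c'_def \<iota>_add \<iota>_mult algebra_simps)
    finally have "\<iota> (A d) ^ Suc n * x ^ Suc n = (\<Sum>i<d. \<iota> (c' i) * x ^ i)" .
    moreover have "degree (c' i) \<le> h * Suc n" for i
    proof -
      have "degree (A j * c k) \<le> h * Suc n" if "j \<le> d" for j k
        using degree_mult_le[of "A j" "c k"] h[OF that] c(1)[of k] by simp
      thus ?thesis by (auto simp: c'_def mult.commute[of "c e"] intro!: degree_add_le)
    qed
    ultimately show ?case by blast
  qed
  show ?thesis
  proof (rule that[of "A d" h d])
    fix n M :: nat assume "n \<le> M"
    obtain c where c: "\<And>i. degree (c i) \<le> h * n"
      "\<iota> (A d) ^ n * x ^ n = (\<Sum>i<d. \<iota> (c i) * x ^ i)" using red by blast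
    have "\<iota> (A d) ^ M * x ^ n = \<iota> (A d) ^ (M - n) * (\<iota> (A d) ^ n * x ^ n)"
      using \<open>n \<le> M\<close> by (simp flip: power_add mult.assoc)
    also have "\<dots> = (\<Sum>i<d. \<iota> (A d ^ (M - n) * c i) * x ^ i)"
      by (simp add: c(2) sum_distrib_left \<iota>_mult \<iota>_power mult.assoc)
    finally have "\<iota> (A d) ^ M * x ^ n = \<dots>" .
    moreover have "degree (A d ^ (M - n) * c i) \<le> h * M" for i
    proof -
      have "degree (A d ^ (M - n) * c i) \<le> degree (A d) * (M - n) + degree (c i)"
        using degree_mult_le[of "A d ^ (M - n)" "c i"] degree_power_le[of "A d" "M - n"] by simp
      also have "\<dots> \<le> h * (M - n) + h * n" using h[of d] c(1)[of i] by (intro add_mono mult_right_mono) auto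
      also have "\<dots> = h * M" using \<open>n \<le> M\<close> by (simp flip: distrib_left)
      finally show ?thesis .
    qed
    ultimately show "\<exists>c. (\<forall>i. degree (c i) \<le> h * M) \<and> \<iota> (A d) ^ M * x ^ n = (\<Sum>i<d. \<iota> (c i) * x ^ i)"
      by (intro exI[of _ "\<lambda>i. A d ^ (M - n) * c i"]) simp
  qed (rule A(1))
qed

text \<open>The values at \<open>x\<close> and \<open>y\<close> of polynomials over F_q[\<theta>]
  whose degrees in \<theta>, \<open>x\<close> and \<open>y\<close> are each at most
  \<open>M\<close>. Building them term by term avoids coefficient families, and closure under sums
  and products follows by induction.\<close>

inductive int_comb :: "'c \<Rightarrow> 'c \<Rightarrow> nat \<Rightarrow> 'c \<Rightarrow> bool" for x y M where
  zero: "int_comb x y M 0"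
| add: "int_comb x y M z \<Longrightarrow> degree c \<le> M \<Longrightarrow> i \<le> M \<Longrightarrow> j \<le> M \<Longrightarrow>
    int_comb x y M (z + \<iota> c * x ^ i * y ^ j)"

lemma int_comb_mono: "int_comb x y M z \<Longrightarrow> M \<le> M' \<Longrightarrow> int_comb x y M' z"
  by (induction rule: int_comb.induct) (auto intro: int_comb.intros)

lemma int_comb_monomial: "degree c \<le> M \<Longrightarrow> i \<le> M \<Longrightarrow> j \<le> M \<Longrightarrow> int_comb x y M (\<iota> c * x ^ i * y ^ j)"
  using int_comb.add[OF int_comb.zero] by fastforce

lemma int_comb_add:
  assumes "int_comb x y M z" "int_comb x y M w"
  shows "int_comb x y M (z + w)"
  using assms(2)
proof induction
  case (add w c i j)
  thus ?case using int_comb.add[of x y M "z + w" c i j] by (simp add: add.assoc)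
qed (use assms(1) in simp)

lemma int_comb_sum: "(\<And>i. i \<in> A \<Longrightarrow> int_comb x y M (f i)) \<Longrightarrow> int_comb x y M (\<Sum>i\<in>A. f i)"
  by (induction A rule: infinite_finite_induct) (auto intro: int_comb.zero int_comb_add)

lemma int_comb_monomial_mult:
  assumes "int_comb x y M z" "degree c \<le> M'" "i \<le> M'" "j \<le> M'"
  shows "int_comb x y (M + M') (z * (\<iota> c * x ^ i * y ^ j))"
  using assms(1)
proof induction
  case (add z d k l)
  have "degree (d * c) \<le> M + M'" using degree_mult_le[of d c] add.hyps assms by linarith
  hence "int_comb x y (M + M') (z * (\<iota> c * x ^ i * y ^ j) + \<iota> (d * c) * x ^ (k + i) * y ^ (l + j))"
    using add assms by (intro int_comb.add) auto
  thus ?case by (simp add: \<iota>_mult power_add algebra_simps)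
qed (simp add: int_comb.zero)

lemma int_comb_mult:
  assumes "int_comb x y M z" "int_comb x y M' w"
  shows "int_comb x y (M + M') (z * w)"
  using assms(2)
proof induction
  case (add w c i j)
  thus ?case using int_comb_add[OF add.IH int_comb_monomial_mult[OF assms(1) add.hyps(2-4)]]
    by (simp add: algebra_simps)
qed (simp add: int_comb.zero)

lemma int_comb_1: "int_comb x y 0 1"
  using int_comb_monomial[of 1 0 0 0 x y] by simp

lemma int_comb_power: "int_comb x y M z \<Longrightarrow> int_comb x y (n * M) (z ^ n)"
  by (induction n) (auto intro: int_comb_mult int_comb_1)

lemma int_comb_prod:
  "finite A \<Longrightarrow> (\<And>i. i \<in> A \<Longrightarrow> int_comb x y (M i) (f i)) \<Longrightarrow> int_comb x y (\<Sum>i\<in>A. M i) (\<Prod>i\<in>A. f i)"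
  by (induction A rule: finite_induct) (auto intro: int_comb_mult int_comb_1)

text \<open>The lowest nonzero term \<open>\<iota> (c k) * z ^ k\<close> has absolute value at least
  |z|^k, since \<open>\<iota> (c k)\<close> has absolute value at least 1. It is minus the sum of
  the other terms, each at most q^E |z|^(k+1).\<close>

lemma absv_ge_of_relation:
  assumes rel: "(\<Sum>l\<le>m. \<iota> (c l) * z ^ l) = 0" and c: "\<exists>l\<le>m. c l \<noteq> 0" "\<And>l. degree (c l) \<le> E"
    and z: "z \<noteq> 0" "absv z \<le> 1"
  shows "1 \<le> absv z * real CARD('a) ^ E"
proof -
  define k where "k = (LEAST l. l \<le> m \<and> c l \<noteq> 0)"
  have "k \<le> m \<and> c k \<noteq> 0"
    unfolding k_def by (rule LeastI_ex) (use c(1) in blast)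
  hence k: "k \<le> m" "c k \<noteq> 0" by simp_all
  have least: "c l = 0" if "l < k" for l
    using not_less_Least[OF that[unfolded k_def]] that k(1) by simp
  have "(\<Sum>l\<le>m. \<iota> (c l) * z ^ l) = \<iota> (c k) * z ^ k + (\<Sum>l\<in>{..m} - {k}. \<iota> (c l) * z ^ l)"
    using k(1) by (intro sum.remove) auto
  hence eq: "\<iota> (c k) * z ^ k = - (\<Sum>l\<in>{..m} - {k}. \<iota> (c l) * z ^ l)"
    using rel by (simp add: eq_neg_iff_add_eq_0)
  have "1 * absv z ^ k \<le> absv (\<iota> (c k)) * absv z ^ k"
    using absv_\<iota>_ge_1[OF k(2)] absv_nonneg by (intro mult_right_mono) auto
  also have "\<dots> = absv (\<Sum>l\<in>{..m} - {k}. \<iota> (c l) * z ^ l)"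
    using arg_cong[OF eq, of absv] by (simp add: absv_mult absv_power absv_minus)
  also have "\<dots> \<le> real CARD('a) ^ E * absv z ^ Suc k"
  proof (intro absv_sum_le)
    fix l assume l: "l \<in> {..m} - {k}"
    show "absv (\<iota> (c l) * z ^ l) \<le> real CARD('a) ^ E * absv z ^ Suc k"
    proof (cases "l < k")
      case True
      thus ?thesis using least by (simp add: absv_0 absv_nonneg)
    next
      case False
      hence "absv z ^ l \<le> absv z ^ Suc k"
        using l z absv_nonneg by (intro power_decreasing) auto
      thus ?thesis unfolding absv_mult absv_power
        using absv_\<iota>_le[OF c(2)] absv_nonneg by (intro mult_mono) auto
    qed
  qed (simp add: absv_nonneg)
  finally have "1 * absv z ^ k \<le> (absv z * real CARD('a) ^ E) * absv z ^ k" by (simp add: mult_ac)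
  thus ?thesis using z(1) by (simp only: mult_le_cancel_right) (simp add: absv_pos_iff zero_less_power)
qed

text \<open>
  Up to a common denominator, the \<open>m + 1\<close> powers \<open>1, z, \<dots>, z^m\<close> are combinations of only
  \<open>m\<close> monomials in \<open>x\<close> and \<open>y\<close>, so \<open>siegel\<close> yields an equation for \<open>z\<close> of small height.
\<close>

lemma liouville:
  assumes x: "algebraic_over (base_K emb) x" and y: "algebraic_over (base_K emb) y"
  obtains C where "\<And>M z. int_comb x y M z \<Longrightarrow> z \<noteq> 0 \<Longrightarrow> absv z \<le> 1 \<Longrightarrow>
    1 \<le> absv z * real CARD('a) ^ (C * (M + 1))"
proof -
  obtain a d h where a: "a \<noteq> 0"
    "\<And>n M. n \<le> M \<Longrightarrow> \<exists>c. (\<forall>i. degree (c i) \<le> h * M) \<and> \<iota> a ^ M * x ^ n = (\<Sum>i<d. \<iota> (c i) * x ^ i)"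
    by (rule algebraic_power_reduction[OF x]) (rule that)
  obtain b e g where b: "b \<noteq> 0"
    "\<And>n M. n \<le> M \<Longrightarrow> \<exists>c. (\<forall>i. degree (c i) \<le> g * M) \<and> \<iota> b ^ M * y ^ n = (\<Sum>i<e. \<iota> (c i) * y ^ i)"
    by (rule algebraic_power_reduction[OF y]) (rule that)
  define J where "J = {..<d} \<times> {..<e}"
  \<comment> \<open>All combinations of bound \<open>M\<close> share one denominator, and the number
    of remaining monomials, \<open>card J\<close>, does not depend on \<open>M\<close>.\<close>
  have red: "\<exists>c. (\<forall>j. degree (c j) \<le> M + h * M + g * M) \<and>
      \<iota> a ^ M * \<iota> b ^ M * z = (\<Sum>j\<in>J. \<iota> (c j) * (x ^ fst j * y ^ snd j))" if "int_comb x y M z" for M z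
    using that
  proof induction
    case zero
    show ?case by (intro exI[of _ "\<lambda>_. 0"]) simp
  next
    case (add z r i j)
    obtain c where c: "\<And>j. degree (c j) \<le> M + h * M + g * M"
      "\<iota> a ^ M * \<iota> b ^ M * z = (\<Sum>j\<in>J. \<iota> (c j) * (x ^ fst j * y ^ snd j))" using add.IH by blast
    obtain u where u: "\<And>i. degree (u i) \<le> h * M" "\<iota> a ^ M * x ^ i = (\<Sum>k<d. \<iota> (u k) * x ^ k)"
      using a(2)[OF add.hyps(3)] by blast
    obtain v where v: "\<And>i. degree (v i) \<le> g * M" "\<iota> b ^ M * y ^ j = (\<Sum>k<e. \<iota> (v k) * y ^ k)"
      using b(2)[OF add.hyps(4)] by blast
    have "\<iota> a ^ M * \<iota> b ^ M * (\<iota> r * x ^ i * y ^ j) = \<iota> r * ((\<iota> a ^ M * x ^ i) * (\<iota> b ^ M * y ^ j))"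
      by simp
    also have "\<dots> = (\<Sum>p\<in>J. \<iota> (r * u (fst p) * v (snd p)) * (x ^ fst p * y ^ snd p))"
      unfolding u(2) v(2) sum_product J_def sum.cartesian_product
      by (subst sum_distrib_left, intro sum.cong refl) (auto simp: \<iota>_mult)
    finally have "\<iota> a ^ M * \<iota> b ^ M * (z + \<iota> r * x ^ i * y ^ j) =
        (\<Sum>p\<in>J. \<iota> (c p + r * u (fst p) * v (snd p)) * (x ^ fst p * y ^ snd p))"
      by (simp add: distrib_left c(2) \<iota>_add distrib_right sum.distrib)
    moreover have "degree (c p + r * u (fst p) * v (snd p)) \<le> M + h * M + g * M" for p
    proof (rule degree_add_le[OF c(1)])
      have "degree (r * u (fst p) * v (snd p)) \<le> degree r + degree (u (fst p)) + degree (v (snd p))"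
        by (meson degree_mult_le add_le_mono order_refl order_trans)
      also have "\<dots> \<le> M + h * M + g * M" using u(1) v(1) add.hyps(2) by (intro add_mono)
      finally show "degree (r * u (fst p) * v (snd p)) \<le> M + h * M + g * M" .
    qed
    ultimately show ?case by (intro exI[of _ "\<lambda>p. c p + r * u (fst p) * v (snd p)"]) simp
  qed
  define m where "m = card J"
  show ?thesis
  proof (rule that)
    fix M z assume z: "int_comb x y M z" "z \<noteq> 0" "absv z \<le> 1"
    \<comment> \<open>The powers \<open>z ^ l\<close> with \<open>l \<le> m\<close> are all
      combinations of bound \<open>m * M\<close>; \<open>E\<close> is the degree bound that
      \<open>red\<close> gives for \<open>m * M\<close>.\<close>
    define E where "E = m * M + h * (m * M) + g * (m * M)"
    have "int_comb x y (m * M) (z ^ l)" if "l \<le> m" for l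
      using int_comb_mono[OF int_comb_power[OF z(1), of l], of "m * M"] that by simp
    hence "\<forall>l\<in>{..m}. \<exists>c. (\<forall>j. degree (c j) \<le> E) \<and>
      \<iota> a ^ (m * M) * \<iota> b ^ (m * M) * z ^ l = (\<Sum>j\<in>J. \<iota> (c j) * (x ^ fst j * y ^ snd j))"
      using red unfolding E_def by blast
    then obtain w where w: "\<And>l j. l \<le> m \<Longrightarrow> degree (w l j) \<le> E"
      "\<And>l. l \<le> m \<Longrightarrow> \<iota> a ^ (m * M) * \<iota> b ^ (m * M) * z ^ l = (\<Sum>j\<in>J. \<iota> (w l j) * (x ^ fst j * y ^ snd j))"
      unfolding bchoice_iff atMost_iff by blast
    obtain c where c: "\<exists>l\<in>{..m}. c l \<noteq> 0" "\<And>l. degree (c l) \<le> E * m"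
      "\<And>j. j \<in> J \<Longrightarrow> (\<Sum>l\<le>m. c l * w l j) = 0"
    proof (rule siegel)
      show "finite {..m}" "finite J" "card J < card {..m}" by (simp_all add: J_def m_def)
      show "\<And>l j. l \<in> {..m} \<Longrightarrow> j \<in> J \<Longrightarrow> degree (w l j) \<le> E" using w(1) by simp
    qed (simp add: m_def)
    have "\<iota> a ^ (m * M) * \<iota> b ^ (m * M) * (\<Sum>l\<le>m. \<iota> (c l) * z ^ l) =
        (\<Sum>l\<le>m. \<iota> (c l) * (\<iota> a ^ (m * M) * \<iota> b ^ (m * M) * z ^ l))"
      by (simp add: sum_distrib_left mult_ac)
    also have "\<dots> = (\<Sum>l\<le>m. \<Sum>j\<in>J. \<iota> (c l * w l j) * (x ^ fst j * y ^ snd j))"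
      by (intro sum.cong refl, subst w(2)) (simp_all add: sum_distrib_left \<iota>_mult mult.assoc)
    also have "\<dots> = (\<Sum>j\<in>J. \<Sum>l\<le>m. \<iota> (c l * w l j) * (x ^ fst j * y ^ snd j))"
      by (rule sum.swap)
    also have "\<dots> = (\<Sum>j\<in>J. \<iota> (\<Sum>l\<le>m. c l * w l j) * (x ^ fst j * y ^ snd j))"
      by (simp add: \<iota>_sum sum_distrib_right)
    also have "\<dots> = 0" by (simp add: c(3))
    finally have "(\<Sum>l\<le>m. \<iota> (c l) * z ^ l) = 0" using a(1) b(1) by simp
    hence "1 \<le> absv z * real CARD('a) ^ (E * m)"
      by (rule absv_ge_of_relation) (use c(1,2) z in auto)
    \<comment> \<open>The constant \<open>C\<close> is thus \<open>(1 + h + g) * m * m\<close>,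
      which depends on \<open>x\<close> and \<open>y\<close> only.\<close>
    also have "E * m \<le> (1 + h + g) * m * m * (M + 1)"
      by (simp add: E_def algebra_simps)
    hence "absv z * real CARD('a) ^ (E * m) \<le> absv z * real CARD('a) ^ ((1 + h + g) * m * m * (M + 1))"
      using card_gt1 absv_nonneg by (intro mult_left_mono power_increasing) auto
    finally show "1 \<le> absv z * real CARD('a) ^ ((1 + h + g) * m * m * (M + 1))" .
  qed
qed

end

section \<open>Transcendence of the power series\<close>

unbundle no vec_syntax
unbundle fps_syntax

definition partial_prod :: "'k::comm_ring_1 \<Rightarrow> nat \<Rightarrow> nat \<Rightarrow> 'k poly"
  where "partial_prod \<theta> q n = (\<Prod>i<n. 1 - monom \<theta> (q ^ Suc i))"

text \<open>The infinite product, read off along the diagonal: for q > 1, the factors left out of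
  \<open>partial_prod \<theta> q m\<close> change only coefficients of index at least q^(m+1), hence
  not the one of index \<open>m\<close>.\<close>

definition prod_fps :: "'k::comm_ring_1 \<Rightarrow> nat \<Rightarrow> 'k fps"
  where "prod_fps \<theta> q = Abs_fps (\<lambda>m. coeff (partial_prod \<theta> q m) m)"

lemma coeff_partial_prod_mono:
  assumes "q > 1" "n \<le> n'" "m < q ^ Suc n"
  shows "coeff (partial_prod \<theta> q n') m = coeff (partial_prod \<theta> q n) m"
  using assms(2)
proof (induction n' rule: dec_induct)
  case (step k)
  have "q ^ Suc n \<le> q ^ Suc k" using assms(1) step.hyps by (intro power_increasing) auto
  hence "m < q ^ Suc k" using assms(3) by linarith
  moreover have "partial_prod \<theta> q (Suc k) = partial_prod \<theta> q k - monom \<theta> (q ^ Suc k) * partial_prod \<theta> q k"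
    by (simp add: partial_prod_def algebra_simps)
  ultimately show ?case using step.IH by (simp add: coeff_monom_mult)
qed simp

lemma coeff_partial_prod:
  assumes "q > 1" "m < q ^ Suc n"
  shows "coeff (partial_prod \<theta> q n) m = prod_fps \<theta> q $ m"
proof (cases "n \<le> m")
  case True
  thus ?thesis using coeff_partial_prod_mono[OF assms(1) True assms(2), of \<theta>] by (simp add: prod_fps_def)
next
  case False
  have "m < q ^ Suc m" using power_gt_expt[of q "Suc m"] assms(1) by simp
  thus ?thesis using coeff_partial_prod_mono[OF assms(1), of m n m \<theta>] False by (simp add: prod_fps_def)
qed

lemma prod_fps_nonzero: "prod_fps \<theta> q \<noteq> 0"
proof -
  have "prod_fps \<theta> q $ 0 = 1" by (simp add: prod_fps_def partial_prod_def)
  thus ?thesis by force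
qed

text \<open>Substituting X^q moves each factor to the next one, so only the first factor has to be
  supplied: the functional equation at finite level.\<close>

lemma partial_prod_Suc_pcompose:
  "partial_prod (\<theta>::'k::field) q (Suc n) = (1 - monom \<theta> q) * pcompose (partial_prod \<theta> q n) (monom 1 q)"
proof -
  have "pcompose (monom c n) p = smult c (p ^ n)" for c :: 'k and n p
    by (induction n) (simp_all add: monom_0 monom_Suc pcompose_pCons)
  thus ?thesis unfolding partial_prod_def
    by (subst prod.lessThan_Suc_shift) (simp add: pcompose_prod pcompose_diff pcompose_1 monom_power smult_monom)
qed

text \<open>Coefficient \<open>m\<close> of either side depends on finitely many factors only, so
  the identity for partial products carries over.\<close>

lemma prod_fps_functional_equation:
  assumes "q > 1"
  shows "prod_fps (\<theta>::'k::field) q = fps_of_poly (1 - monom \<theta> q) * (prod_fps \<theta> q oo fps_X ^ q)"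
proof (rule fps_ext)
  fix m
  let ?t = "fps_of_poly (1 - monom \<theta> q)" and ?P = "fps_of_poly (partial_prod \<theta> q m)"
  have lt: "i < q ^ Suc m" if "i \<le> m" for i
    using that power_gt_expt[of q "Suc m"] assms by simp
  have "prod_fps \<theta> q $ m = fps_of_poly (partial_prod \<theta> q (Suc m)) $ m"
    using coeff_partial_prod[OF assms, of m "Suc m" \<theta>] power_gt_expt[of q "Suc (Suc m)"] assms by simp
  also have "fps_of_poly (partial_prod \<theta> q (Suc m)) = ?t * (?P oo fps_X ^ q)"
    using assms by (simp add: partial_prod_Suc_pcompose fps_of_poly_mult fps_of_poly_pcompose fps_of_poly_monom')
  also have "\<dots> $ m = (?t * (prod_fps \<theta> q oo fps_X ^ q)) $ m"
    unfolding fps_mult_nth fps_compose_nth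
    using assms lt by (intro sum.cong refl arg_cong2[of _ _ _ _ "(*)"]) (simp_all add: coeff_partial_prod)
  finally show "prod_fps \<theta> q $ m = (?t * (prod_fps \<theta> q oo fps_X ^ q)) $ m" .
qed

text \<open>
  Once \<open>u\<close> and \<open>v\<close> have no common root, the factor vanishing at \<open>\<rho> 1\<close> forces either all \<open>\<rho> m\<close>
  with \<open>m \<ge> 1\<close> to be roots of \<open>u\<close> or all \<open>1/\<theta>^(q^m)\<close> to be roots of \<open>v\<close>.
\<close>

lemma no_rational_cocycle:
  fixes \<theta> :: "'k::field" and u v :: "'k poly"
  assumes q: "q > 1" and d: "d > 0" and \<theta>: "\<theta> \<noteq> 0" "\<And>n. n > 0 \<Longrightarrow> \<theta> ^ n \<noteq> 1"
    and \<rho>: "\<rho> 0 = inverse \<theta>" "\<And>m. \<rho> (Suc m) ^ q = \<rho> m"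
    and uv: "u \<noteq> 0" "v \<noteq> 0"
    and eq: "u * pcompose v (monom 1 q) = v * pcompose u (monom 1 q) * (1 - monom \<theta> q) ^ d"
  shows False
  using uv eq
\<comment> \<open>The equation says that u/v satisfies the functional equation of F^d. The induction
  serves to cancel common roots of \<open>u\<close> and \<open>v\<close>.\<close>
proof (induction "degree u" arbitrary: u v rule: less_induct)
  case less
  note eq = less.prems(3)
  show False
  proof (cases "\<exists>x. poly u x = 0 \<and> poly v x = 0")
    case True
    then obtain x where "poly u x = 0" "poly v x = 0" by blast
    then obtain u' v' where uv': "u = [:-x, 1:] * u'" "v = [:-x, 1:] * v'"
      unfolding poly_eq_0_iff_dvd by (blast elim: dvdE)
    have nz: "u' \<noteq> 0" "v' \<noteq> 0" using less.prems uv' by auto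
    let ?s = "pcompose [:-x, 1:] (monom 1 q)"
    have "coeff ?s q = 1" using q by (simp add: pcompose_pCons coeff_pCons split: nat.splits)
    hence s: "?s \<noteq> 0" by force
    \<comment> \<open>A common root \<open>x\<close> contributes the same factors X - x and X^q - x
      to both sides.\<close>
    have "([:-x, 1:] * ?s) * (u' * pcompose v' (monom 1 q)) =
        ([:-x, 1:] * ?s) * (v' * pcompose u' (monom 1 q) * (1 - monom \<theta> q) ^ d)"
      using eq unfolding uv' pcompose_mult by (simp only: mult_ac)
    hence "u' * pcompose v' (monom 1 q) = v' * pcompose u' (monom 1 q) * (1 - monom \<theta> q) ^ d"
      using mult_left_cancel[OF no_zero_divisors[OF _ s]] by (metis pCons_eq_0_iff one_neq_zero)
    moreover have "degree u' < degree u" 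
      using nz degree_mult_eq[of "[:-x, 1:]" u'] unfolding uv'(1) by (simp del: mult_pCons_left)
    ultimately show False using less.hyps nz by blast
  next
    case False
    have ev: "poly u x * poly v (x ^ q) = poly v x * poly u (x ^ q) * (1 - \<theta> * x ^ q) ^ d" for x
      using arg_cong[OF eq, of "\<lambda>p. poly p x"] by (simp add: poly_pcompose poly_monom)
    have pow: "i = j" if "\<theta> ^ (q ^ i) = \<theta> ^ (q ^ j)" for i j
    proof -
      have aux: "\<not> i < j" if "\<theta> ^ (q ^ i) = \<theta> ^ (q ^ j)" for i j
      proof
        assume "i < j"
        hence "q ^ i < q ^ j" using q by simp
        moreover from this have "\<theta> ^ (q ^ j - q ^ i) * \<theta> ^ (q ^ i) = \<theta> ^ (q ^ j)"
          by (simp flip: power_add)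
        hence "\<theta> ^ (q ^ j - q ^ i) * \<theta> ^ (q ^ i) = 1 * \<theta> ^ (q ^ i)" using that by simp
        ultimately show False using \<theta>(2)[of "q ^ j - q ^ i"] \<theta>(1) by simp
      qed
      from aux[OF that] aux[OF that[symmetric]] show ?thesis by simp
    qed
    \<comment> \<open>Since \<open>\<rho> 1 ^ q\<close> is 1/\<theta> and d > 0, the right side
      vanishes at \<open>\<rho> 1\<close>.\<close>
    have "poly u (\<rho> 1) * poly v (\<rho> 0) = 0"
      using ev[of "\<rho> 1"] \<rho>(2)[of 0] \<rho>(1) \<theta>(1) d by simp
    hence "poly u (\<rho> 1) = 0 \<or> poly v (\<rho> 0) = 0" by simp
    thus False
    proof
      assume "poly u (\<rho> 1) = 0"
      \<comment> \<open>A zero of \<open>u\<close> at \<open>\<rho> (Suc m)\<close> makes the right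
        side vanish at the next root in the chain, while \<open>v\<close> is nonzero at
        \<open>\<rho> (Suc m)\<close>; so \<open>u\<close> vanishes at that next root.\<close>
      hence "poly u (\<rho> (Suc m)) = 0" for m
      proof (induction m)
        case (Suc m)
        have "poly v (\<rho> (Suc m)) \<noteq> 0" using Suc False by auto
        moreover have "poly u (\<rho> (Suc (Suc m))) * poly v (\<rho> (Suc m)) = 0"
          using ev[of "\<rho> (Suc (Suc m))"] \<rho>(2)[of "Suc m"] Suc by simp
        ultimately show ?case by simp
      qed simp
      hence "range (\<lambda>m. \<rho> (Suc m)) \<subseteq> {x. poly u x = 0}" by auto
      hence "finite (range (\<lambda>m. \<rho> (Suc m)))"
        using poly_roots_finite[OF less.prems(1)] finite_subset by blast
      moreover have "inj (\<lambda>m. \<rho> (Suc m))"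
      proof (rule injI)
        fix i j assume ij: "\<rho> (Suc i) = \<rho> (Suc j)"
        have down: "\<rho> (k + m) ^ (q ^ m) = \<rho> k" for k m
          by (induction m) (simp_all add: \<rho>(2) power_mult)
        \<comment> \<open>Raising the common value to the power \<open>q ^ Suc i * q ^ Suc j\<close>
          in both orders gives two inverse powers of \<theta>, which \<open>pow\<close>
          distinguishes.\<close>
        have "inverse (\<theta> ^ (q ^ Suc j)) = \<rho> (Suc i) ^ (q ^ Suc i * q ^ Suc j)"
          using down[of 0 "Suc i"] by (simp add: \<rho>(1) power_mult power_inverse del: power_Suc)
        also have "\<dots> = (\<rho> (Suc j) ^ (q ^ Suc j)) ^ (q ^ Suc i)"
          unfolding ij by (subst mult.commute) (rule power_mult)
        also have "\<dots> = inverse (\<theta> ^ (q ^ Suc i))"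
          using down[of 0 "Suc j"] by (simp add: \<rho>(1) power_inverse del: power_Suc)
        finally show "i = j" using pow[of "Suc j" "Suc i"] by simp
      qed
      ultimately show False using finite_imageD infinite_UNIV_nat by blast
    next
      assume "poly v (\<rho> 0) = 0"
      \<comment> \<open>Here zeros spread the other way, from \<open>x\<close> to
        \<open>x ^ q\<close>: where \<open>v\<close> vanishes so does the right side, while
        \<open>u\<close> does not vanish there.\<close>
      hence "poly v (inverse \<theta> ^ (q ^ m)) = 0" for m
      proof (induction m)
        case (Suc m)
        have "poly u (inverse \<theta> ^ (q ^ m)) \<noteq> 0" using Suc False by auto
        moreover have "poly u (inverse \<theta> ^ (q ^ m)) * poly v ((inverse \<theta> ^ (q ^ m)) ^ q) = 0"
          using ev[of "inverse \<theta> ^ (q ^ m)"] Suc by simp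
        ultimately show ?case by (simp add: power_mult[symmetric] mult.commute)
      qed (simp add: \<rho>(1))
      hence "range (\<lambda>m. inverse \<theta> ^ (q ^ m)) \<subseteq> {x. poly v x = 0}" by auto
      hence "finite (range (\<lambda>m. inverse \<theta> ^ (q ^ m)))"
        using poly_roots_finite[OF less.prems(2)] finite_subset by blast
      moreover have "inj (\<lambda>m. inverse \<theta> ^ (q ^ m))"
        using pow by (auto simp: inj_def power_inverse)
      ultimately show False using finite_imageD infinite_UNIV_nat by blast
    qed
  qed
qed

text \<open>
  Substituting \<open>X^q\<close> into a relation of minimal degree gives a proportional one; comparing its
  constant and leading coefficients leads to \<open>no_rational_cocycle\<close>.
\<close>

lemma prod_fps_transcendental:
  fixes \<theta> :: "'k::field" and a :: "nat \<Rightarrow> 'k poly"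
  assumes q: "q > 1" and \<theta>: "\<theta> \<noteq> 0" "\<And>n. n > 0 \<Longrightarrow> \<theta> ^ n \<noteq> 1"
    and \<rho>: "\<rho> 0 = inverse \<theta>" "\<And>m. \<rho> (Suc m) ^ q = \<rho> m"
    and rel: "(\<Sum>i\<le>n. fps_of_poly (a i) * prod_fps \<theta> q ^ i) = 0"
    and i: "i \<le> n"
  shows "a i = 0"
proof (rule ccontr)
  assume "a i \<noteq> 0"
  let ?F = "prod_fps \<theta> q" and ?G = "prod_fps \<theta> q oo fps_X ^ q" and ?\<sigma> = "\<lambda>p. pcompose p (monom 1 q)"
  define t where "t = 1 - monom \<theta> q"
  define R where "R d \<longleftrightarrow> (\<exists>b. b d \<noteq> 0 \<and> (\<Sum>i\<le>d. fps_of_poly (b i) * ?F ^ i) = 0)" for d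
  have R: "\<exists>d\<le>m. R d" if "(\<Sum>i\<le>m. fps_of_poly (b i) * ?F ^ i) = 0" "\<exists>i\<le>m. b i \<noteq> 0" for b m
    using that
  proof (induction m)
    case (Suc m)
    show ?case
    proof (cases "b (Suc m) = 0")
      case True
      with Suc.prems have "(\<Sum>i\<le>m. fps_of_poly (b i) * ?F ^ i) = 0" "\<exists>i\<le>m. b i \<noteq> 0"
        by (auto simp: le_Suc_eq)
      thus ?thesis using Suc.IH le_SucI by blast
    next
      case False
      thus ?thesis using Suc.prems(1) unfolding R_def by blast
    qed
  qed (auto simp: R_def)
  define d where "d = (LEAST d. R d)"
  have "R d" unfolding d_def using R[OF rel] i \<open>a i \<noteq> 0\<close> by (metis LeastI)
  have least: "\<not> R e" if "e < d" for e using that not_less_Least unfolding d_def by blast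
  obtain b where b: "b d \<noteq> 0" "(\<Sum>i\<le>d. fps_of_poly (b i) * ?F ^ i) = 0"
    using \<open>R d\<close> unfolding R_def by blast
  have "d > 0" using b by (cases d) (auto simp: fps_of_poly_eq_iff[of _ 0, simplified])
  then obtain e where e: "d = Suc e" by (cases d) auto
  \<comment> \<open>Otherwise the relation could be divided by the nonzero series, against the
    minimality of \<open>d\<close>.\<close>
  have b0: "b 0 \<noteq> 0"
  proof
    assume "b 0 = 0"
    have "?F * (\<Sum>i\<le>e. fps_of_poly (b (Suc i)) * ?F ^ i) = (\<Sum>i\<le>d. fps_of_poly (b i) * ?F ^ i)"
      unfolding e by (subst sum.atMost_Suc_shift) (simp add: \<open>b 0 = 0\<close> sum_distrib_left mult_ac)
    hence "(\<Sum>i\<le>e. fps_of_poly (b (Suc i)) * ?F ^ i) = 0" using b(2) prod_fps_nonzero[of \<theta> q] by simp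
    hence "R e" unfolding R_def using b(1) e by (intro exI[of _ "\<lambda>i. b (Suc i)"]) simp
    thus False using least e by simp
  qed
  have X: "(fps_X ^ q :: 'k fps) $ 0 = 0" using q by simp
  have F: "?F = fps_of_poly t * ?G" unfolding t_def by (rule prod_fps_functional_equation[OF q])
  have "(\<Sum>i\<le>d. fps_of_poly (?\<sigma> (b i)) * ?G ^ i) = (\<Sum>i\<le>d. fps_of_poly (b i) * ?F ^ i) oo fps_X ^ q"
    using q by (simp add: fps_compose_sum_distrib fps_compose_mult_distrib[OF X] fps_compose_power[OF X]
        fps_of_poly_pcompose fps_of_poly_monom')
  hence G: "(\<Sum>i\<le>d. fps_of_poly (?\<sigma> (b i)) * ?G ^ i) = 0" by (simp add: b(2))
  \<comment> \<open>Multiplying by \<open>t ^ d\<close> turns powers of \<open>?G\<close> back into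
    powers of \<open>?F\<close>, because \<open>?F\<close> is \<open>t\<close> times
    \<open>?G\<close>.\<close>
  have "(\<Sum>i\<le>d. fps_of_poly (?\<sigma> (b i) * t ^ (d - i)) * ?F ^ i) =
      (\<Sum>i\<le>d. fps_of_poly t ^ d * (fps_of_poly (?\<sigma> (b i)) * ?G ^ i))"
  proof (intro sum.cong refl)
    fix i assume "i \<in> {..d}"
    hence "fps_of_poly t ^ (d - i) * fps_of_poly t ^ i = fps_of_poly t ^ d" by (simp flip: power_add)
    thus "fps_of_poly (?\<sigma> (b i) * t ^ (d - i)) * ?F ^ i = fps_of_poly t ^ d * (fps_of_poly (?\<sigma> (b i)) * ?G ^ i)"
      by (subst F) (simp add: fps_of_poly_mult fps_of_poly_power power_mult_distrib mult_ac)
  qed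
  also have "\<dots> = 0" using G by (simp flip: sum_distrib_left)
  finally have \<sigma>rel: "(\<Sum>i\<le>d. fps_of_poly (?\<sigma> (b i) * t ^ (d - i)) * ?F ^ i) = 0" .
  \<comment> \<open>Cross-multiplication removes the leading term. By minimality the other
    coefficients vanish too, and \<open>c 0 = 0\<close> is the equation of
    \<open>no_rational_cocycle\<close> for \<open>b 0\<close> and \<open>b d\<close>.\<close>
  define c where "c i = ?\<sigma> (b d) * b i - b d * (?\<sigma> (b i) * t ^ (d - i))" for i
  have "(\<Sum>i\<le>d. fps_of_poly (c i) * ?F ^ i) =
      fps_of_poly (?\<sigma> (b d)) * (\<Sum>i\<le>d. fps_of_poly (b i) * ?F ^ i) -
      fps_of_poly (b d) * (\<Sum>i\<le>d. fps_of_poly (?\<sigma> (b i) * t ^ (d - i)) * ?F ^ i)"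
    by (simp add: c_def fps_of_poly_diff fps_of_poly_mult left_diff_distrib sum_subtractf
        sum_distrib_left mult.assoc)
  hence "(\<Sum>i\<le>d. fps_of_poly (c i) * ?F ^ i) = 0" by (simp add: b(2) \<sigma>rel)
  moreover have "c d = 0" by (simp add: c_def)
  ultimately have "(\<Sum>i\<le>e. fps_of_poly (c i) * ?F ^ i) = 0" by (simp add: e)
  hence "c 0 = 0" using R[of c e] least e by (meson le_imp_less_Suc zero_le)
  hence "b 0 * ?\<sigma> (b d) = b d * ?\<sigma> (b 0) * (1 - monom \<theta> q) ^ d"
    by (simp add: c_def t_def mult_ac)
  thus False using no_rational_cocycle[OF q \<open>d > 0\<close> \<theta> \<rho> b0 b(1)] by blast
qed

section \<open>Behaviour of the product near the origin\<close>

lemma fps_mult_nth_cong: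
  fixes f g :: "'k::comm_ring_1 fps"
  assumes "\<And>i. i \<le> k \<Longrightarrow> f $ i = f' $ i" "\<And>i. i \<le> k \<Longrightarrow> g $ i = g' $ i" "m \<le> k"
  shows "(f * g) $ m = (f' * g') $ m"
  unfolding fps_mult_nth using assms by (intro sum.cong) auto

lemma fps_power_nth_cong:
  fixes f :: "'k::comm_ring_1 fps"
  assumes "\<And>i. i \<le> k \<Longrightarrow> f $ i = f' $ i" "m \<le> k"
  shows "(f ^ n) $ m = (f' ^ n) $ m"
  using assms(2)
proof (induction n arbitrary: m)
  case (Suc n)
  show ?case unfolding power_Suc
    by (rule fps_mult_nth_cong[where k = k]) (use assms(1) Suc in auto)
qed simp

context completed_algebraic_closure
begin

text \<open>The points of the open unit disc at which no factor vanishes. This set is stable under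
  q-th powers, along which the functional equation is iterated.\<close>

definition regular :: "'c \<Rightarrow> bool"
  where "regular x \<longleftrightarrow> absv x < 1 \<and> (\<forall>n\<ge>1. theta emb * x ^ (CARD('a) ^ n) \<noteq> 1)"

lemma regular_power:
  assumes "regular x"
  shows "regular (x ^ (CARD('a) ^ n))"
proof -
  have "absv x ^ (CARD('a) ^ n) < 1"
    using assms absv_nonneg[of x] power_strict_mono[of "absv x" 1 "CARD('a) ^ n"] by (simp add: regular_def)
  moreover have "(x ^ (CARD('a) ^ n)) ^ (CARD('a) ^ m) = x ^ (CARD('a) ^ (n + m))" for m
    by (simp add: power_add power_mult)
  ultimately show ?thesis using assms by (simp add: regular_def absv_power)
qed

text \<open>The predicate \<open>has_prod\<close> takes limits of tails behind a zero factor;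
  without zero factors the value is the plain limit of the partial products.\<close>

lemma LIMSEQ_f_De:
  assumes "regular x"
  shows "(\<lambda>n. \<Prod>i\<le>n. f_De_factor emb x i) \<longlonglongrightarrow> f_De emb x"
proof -
  have "f_De_factor emb x n \<noteq> 0" for n
  proof
    assume "f_De_factor emb x n = 0"
    hence "theta emb * x ^ (CARD('a) ^ Suc n) = 1" by (simp add: f_De_factor_def)
    moreover have "Suc n \<ge> 1" by simp
    ultimately show False using assms unfolding regular_def by blast
  qed
  moreover have "f_De_factor emb x has_prod f_De emb x"
    using assms by (intro has_prod_f_De) (simp add: regular_def)
  ultimately show ?thesis by (auto simp: has_prod_def raw_has_prod_def)
qed

lemma f_De_functional_equation:
  assumes "regular x"
  shows "f_De emb x = (1 - theta emb * x ^ CARD('a)) * f_De emb (x ^ CARD('a))"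
proof -
  have "regular (x ^ CARD('a))" using regular_power[OF assms, of 1] by simp
  from tendsto_cmult[OF LIMSEQ_f_De[OF this], of "1 - theta emb * x ^ CARD('a)"]
  have "(\<lambda>n. \<Prod>i\<le>Suc n. f_De_factor emb x i) \<longlonglongrightarrow>
      (1 - theta emb * x ^ CARD('a)) * f_De emb (x ^ CARD('a))"
    by (simp add: prod.atMost_Suc_shift f_De_factor_def flip: power_mult del: prod.atMost_Suc)
  moreover have "(\<lambda>n. \<Prod>i\<le>Suc n. f_De_factor emb x i) \<longlonglongrightarrow> f_De emb x"
    by (rule LIMSEQ_Suc[OF LIMSEQ_f_De[OF assms]])
  ultimately show ?thesis by (rule LIMSEQ_unique[rotated])
qed

lemma f_De_iterate:
  assumes "regular x"
  shows "f_De emb x = poly (partial_prod (theta emb) CARD('a) n) x * f_De emb (x ^ (CARD('a) ^ n))"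
proof (induction n)
  case (Suc n)
  show ?case
    using f_De_functional_equation[OF regular_power[OF assms, of n]] Suc
    by (simp add: partial_prod_def poly_monom mult.commute flip: power_mult)
qed (simp add: partial_prod_def)

text \<open>The first factor deviates most from 1, and by the ultrametric inequality the deviations
  of the factors do not add up.\<close>

lemma absv_f_De_minus_1_le:
  assumes x: "regular x" and less: "real CARD('a) * absv x ^ CARD('a) < 1"
  shows "absv (f_De emb x - 1) \<le> real CARD('a) * absv x ^ CARD('a)"
proof -
  define \<delta> where "\<delta> = real CARD('a) * absv x ^ CARD('a)"
  define P where "P n = (\<Prod>i\<le>n. f_De_factor emb x i)" for n
  have \<delta>: "\<delta> \<ge> 0" "\<delta> < 1" using less absv_nonneg by (simp_all add: \<delta>_def)
  define s where "s n = theta emb * x ^ (CARD('a) ^ Suc n)" for n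
  have s: "absv (s n) \<le> \<delta>" for n
  proof -
    have "CARD('a) ^ 1 \<le> CARD('a) ^ Suc n" using card_gt1 by (intro power_increasing) auto
    hence "absv x ^ (CARD('a) ^ Suc n) \<le> absv x ^ CARD('a)"
      using x absv_nonneg[of x] by (intro power_decreasing) (auto simp: regular_def)
    thus ?thesis unfolding \<delta>_def s_def absv_mult absv_power absv_theta by (intro mult_left_mono) auto
  qed
  have P: "absv (P n - 1) \<le> \<delta>" for n
  proof (induction n)
    case 0
    show ?case using s[of 0] by (simp add: P_def f_De_factor_def s_def absv_minus)
  next
    case (Suc n)
    have "absv (P n) \<le> 1"
      using absv_add_le_max[of "P n - 1" 1] Suc \<delta> by (simp add: absv_1)
    hence le: "absv (P n * s (Suc n)) \<le> 1 * \<delta>"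
      unfolding absv_mult[of "P n"] by (intro mult_mono s absv_nonneg) auto
    have eq: "P (Suc n) - 1 = (P n - 1) - P n * s (Suc n)"
      by (simp add: P_def f_De_factor_def s_def algebra_simps)
    show ?case unfolding eq
      using absv_diff_le_max[of "P n - 1" "P n * s (Suc n)"] Suc le by simp
  qed
  have "(\<lambda>n. dist (P n) 1) \<longlonglongrightarrow> dist (f_De emb x) 1"
    using LIMSEQ_f_De[OF x] unfolding P_def by (intro tendsto_intros)
  hence "dist (f_De emb x) 1 \<le> \<delta>"
    by (rule LIMSEQ_le_const2) (use P in \<open>auto simp: dist_eq_absv\<close>)
  thus ?thesis by (simp add: dist_eq_absv \<delta>_def)
qed

lemma absv_f_De_eq_1:
  assumes "regular x" "real CARD('a) * absv x ^ CARD('a) < 1"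
  shows "absv (f_De emb x) = 1"
  using absv_f_De_minus_1_le[OF assms] assms(2) absv_add_eq[of "f_De emb x - 1" 1] by (simp add: absv_1)

section \<open>Polynomials and polynomial expressions in the product close to 0\<close>

lemma absv_poly_bounded:
  obtains B where "B > 0" "\<And>z. absv z \<le> 1 \<Longrightarrow> absv (poly p z) \<le> B"
proof -
  have "\<exists>B>0. \<forall>z. absv z \<le> 1 \<longrightarrow> absv (poly p z) \<le> B"
  proof (induction p)
    case 0
    show ?case by (intro exI[of _ 1]) (simp add: absv_0)
  next
    case (pCons c p)
    then obtain B where B: "B > 0" "\<And>z. absv z \<le> 1 \<Longrightarrow> absv (poly p z) \<le> B" by blast
    have "absv (poly (pCons c p) z) \<le> max (absv c) B" if "absv z \<le> 1" for z
    proof -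
      have "absv z * absv (poly p z) \<le> 1 * B"
        using B that absv_nonneg by (intro mult_mono) auto
      thus ?thesis using absv_add_le_max[of c "z * poly p z"] by (simp add: absv_mult)
    qed
    thus ?case using B(1) by (intro exI[of _ "max (absv c) B"]) auto
  qed
  thus ?thesis using that by blast
qed

text \<open>The lowest term dominates strictly near 0, so the ultrametric inequality gives an
  equality.\<close>

lemma absv_poly_near_0:
  assumes "\<And>i. i < k \<Longrightarrow> coeff p i = 0" "coeff p k \<noteq> 0"
  obtains r where "r > 0" "\<And>z. absv z < r \<Longrightarrow> absv (poly p z) = absv (coeff p k) * absv z ^ k"
proof -
  have "\<exists>r>0. \<forall>z. absv z < r \<longrightarrow> absv (poly p z) = absv (coeff p k) * absv z ^ k"
    using assms
  proof (induction k arbitrary: p)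
    case 0
    obtain c p' where p: "p = pCons c p'" by (cases p)
    obtain B where B: "B > 0" "\<And>z. absv z \<le> 1 \<Longrightarrow> absv (poly p' z) \<le> B"
      using absv_poly_bounded[of p'] by metis
    have c: "absv c > 0" using 0 by (simp add: p absv_pos_iff)
    have "absv (poly p z) = absv c" if z: "absv z < min 1 (absv c / B)" for z
    proof -
      have "absv z * absv (poly p' z) \<le> absv z * B"
        using B(2)[of z] z absv_nonneg[of z] by (intro mult_left_mono) auto
      also have "\<dots> < absv c" using z B(1) by (simp add: field_simps)
      finally show ?thesis by (simp add: p absv_mult absv_add_eq)
    qed
    thus ?case using c B(1) by (intro exI[of _ "min 1 (absv c / B)"]) (simp add: p)
  next
    case (Suc k)
    obtain c p' where p: "p = pCons c p'" by (cases p)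
    have "c = 0" using Suc.prems(1)[of 0] by (simp add: p)
    have "coeff p' i = 0" if "i < k" for i using Suc.prems(1)[of "Suc i"] that by (simp add: p)
    with Suc.IH[of p'] Suc.prems(2) show ?case by (auto simp: p \<open>c = 0\<close> absv_mult mult_ac)
  qed
  thus ?thesis using that by blast
qed

lemma absv_power_diff_le:
  assumes "absv x \<le> 1" "absv y \<le> 1"
  shows "absv (x ^ n - y ^ n) \<le> absv (x - y)"
proof (induction n)
  case (Suc n)
  have "x ^ Suc n - y ^ Suc n = x * (x ^ n - y ^ n) + (x - y) * y ^ n" by (simp add: algebra_simps)
  moreover have "absv (x * (x ^ n - y ^ n)) \<le> 1 * absv (x - y)"
    unfolding absv_mult using assms Suc absv_nonneg by (intro mult_mono) auto
  moreover have "absv ((x - y) * y ^ n) \<le> absv (x - y) * 1"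
    unfolding absv_mult absv_power using assms absv_nonneg by (intro mult_left_mono power_le_one) auto
  ultimately show ?case using absv_add_le_max[of "x * (x ^ n - y ^ n)" "(x - y) * y ^ n"] by simp
qed (simp add: absv_0 absv_nonneg)

text \<open>The link between formal series and values. With \<open>k\<close> the order of
  \<open>\<Phi>\<close>, replacing the product by its first \<open>k\<close> factors keeps the
  coefficients up to \<open>k\<close> and changes the value by O(|z|^(k+1)), less than the leading
  term of order \<open>k\<close>.\<close>

lemma absv_poly_f_De_near_0:
  fixes A :: "nat \<Rightarrow> 'c poly" and n :: nat
  defines "\<Phi> \<equiv> (\<Sum>j\<le>n. fps_of_poly (A j) * prod_fps (theta emb) CARD('a) ^ j)"
  assumes "\<Phi> \<noteq> 0"
  obtains r c where "r > 0" "c > 0" "\<And>z. regular z \<Longrightarrow> z \<noteq> 0 \<Longrightarrow> absv z < r \<Longrightarrow>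
    absv (\<Sum>j\<le>n. poly (A j) z * f_De emb z ^ j) = c * absv z ^ subdegree \<Phi>"
proof -
  define k where "k = subdegree \<Phi>"
  define q where "q = CARD('a)"
  define P where "P = partial_prod (theta emb) q k"
  define G where "G = (\<Sum>j\<le>n. A j * P ^ j)"
  have q: "q > 1" using card_gt1 by (simp add: q_def)
  have k_less: "k < q ^ k" using q power_gt_expt[of q k] by simp
  have P: "coeff P i = prod_fps (theta emb) q $ i" if "i \<le> k" for i
  proof -
    have "q ^ k \<le> q ^ Suc k" using q by simp
    hence "i < q ^ Suc k" using that k_less by linarith
    thus ?thesis unfolding P_def by (rule coeff_partial_prod[OF q])
  qed
  have G: "coeff G i = \<Phi> $ i" if "i \<le> k" for i
  proof -
    have "coeff G i = (\<Sum>j\<le>n. (fps_of_poly (A j) * fps_of_poly P ^ j) $ i)"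
      by (simp add: G_def coeff_sum flip: fps_of_poly_mult fps_of_poly_power)
    also have "\<dots> = (\<Sum>j\<le>n. (fps_of_poly (A j) * prod_fps (theta emb) q ^ j) $ i)"
      by (intro sum.cong refl fps_mult_nth_cong[where k = k] fps_power_nth_cong[where k = k])
         (use P that in auto)
    finally show ?thesis by (simp add: \<Phi>_def fps_sum_nth q_def)
  qed
  have "\<Phi> $ k \<noteq> 0" using assms unfolding k_def by (intro nth_subdegree_nonzero)
  hence Gk: "coeff G k \<noteq> 0" by (simp add: G)
  obtain r0 where r0: "r0 > 0" "\<And>z. absv z < r0 \<Longrightarrow> absv (poly G z) = absv (coeff G k) * absv z ^ k"
    by (rule absv_poly_near_0[of k G]) (use G Gk in \<open>auto simp: k_def\<close>)
  define c where "c = absv (coeff G k)"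
  have c: "c > 0" using Gk by (simp add: c_def absv_pos_iff)
  have "\<exists>B>0. \<forall>z. absv z \<le> 1 \<longrightarrow> absv (poly (A j) z) \<le> B" for j
    using absv_poly_bounded[of "A j"] by metis
  then obtain b where b: "\<And>j. b j > 0" "\<And>j z. absv z \<le> 1 \<Longrightarrow> absv (poly (A j) z) \<le> b j" by metis
  define B where "B = Max (b ` {..n})"
  have B: "b j \<le> B" if "j \<le> n" for j using that unfolding B_def by (intro Max_ge) auto
  have "B > 0" using b(1)[of 0] B[of 0] by simp
  \<comment> \<open>The bound \<open>1 / real q\<close> makes the product have absolute value 1 at
    \<open>z\<close> and at \<open>w\<close> below; \<open>c / (B * real q)\<close> makes the error
    smaller than the leading term.\<close>
  define r where "r = min r0 (min (1 / real q) (c / (B * real q)))"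
  have "r > 0" using r0 c \<open>B > 0\<close> q by (simp add: r_def)
  moreover have "absv (\<Sum>j\<le>n. poly (A j) z * f_De emb z ^ j) = c * absv z ^ k"
    if z: "regular z" "absv z < r" "z \<noteq> 0" for z
  proof -
    have z0: "absv z > 0" using z(3) by (simp add: absv_pos_iff)
    have z1: "absv z < 1" using z(1) by (simp add: regular_def)
    \<comment> \<open>After \<open>k\<close> steps of the functional equation,
      \<open>f_De emb z\<close> is \<open>poly P z\<close> times \<open>f_De emb w\<close>, and the
      latter factor is extremely close to 1.\<close>
    define w where "w = z ^ (q ^ k)"
    have le: "real q * absv u ^ q < 1" if "absv u \<le> absv z" for u
    proof -
      have "absv u ^ q \<le> absv u ^ 1"
        using that z1 q absv_nonneg[of u] by (intro power_decreasing) auto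
      also have "\<dots> < 1 / real q" using that z(2) by (simp add: r_def)
      finally show ?thesis using q by (simp add: field_simps)
    qed
    have "absv w \<le> absv z ^ 1"
      unfolding w_def absv_power using z0 z1 q by (intro power_decreasing) auto
    hence w: "real q * absv w ^ q < 1" by (intro le) simp
    have reg: "regular w" unfolding w_def q_def using z(1) by (rule regular_power)
    have f1: "absv (f_De emb z) = 1" "absv (f_De emb w) = 1"
      using absv_f_De_eq_1 z(1) reg le[of z] w by (simp_all add: q_def)
    have fP: "f_De emb z = poly P z * f_De emb w"
      unfolding P_def w_def q_def using z(1) by (rule f_De_iterate)
    have P1: "absv (poly P z) = 1" using f1 arg_cong[OF fP, of absv] by (simp add: absv_mult)
    have "f_De emb z - poly P z = poly P z * (f_De emb w - 1)" by (simp add: fP algebra_simps)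
    hence "absv (f_De emb z - poly P z) \<le> real q * absv w ^ q"
      using absv_f_De_minus_1_le[OF reg] w by (simp add: absv_mult P1 q_def)
    also have "absv w ^ q = absv z ^ (q ^ Suc k)"
      by (simp add: w_def absv_power mult.commute flip: power_mult)
    also have "\<dots> \<le> absv z ^ Suc k"
    proof (intro power_decreasing)
      have "Suc k \<le> q ^ k" using k_less by simp
      also have "\<dots> \<le> q ^ Suc k" using q by simp
      finally show "Suc k \<le> q ^ Suc k" .
    qed (use z0 z1 in auto)
    finally have fP': "absv (f_De emb z - poly P z) \<le> real q * absv z ^ Suc k" using q by simp
    define S where "S = (\<Sum>j\<le>n. poly (A j) z * (f_De emb z ^ j - poly P z ^ j))"
    have "absv S \<le> B * (real q * absv z ^ Suc k)"
      unfolding S_def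
    proof (rule absv_sum_le)
      fix j assume "j \<in> {..n}"
      hence "absv (poly (A j) z) \<le> B" using b(2)[of z j] B[of j] z1 by simp
      moreover have "absv (f_De emb z ^ j - poly P z ^ j) \<le> real q * absv z ^ Suc k"
        using absv_power_diff_le[of "f_De emb z" "poly P z" j] f1 P1 fP' by simp
      ultimately show "absv (poly (A j) z * (f_De emb z ^ j - poly P z ^ j)) \<le> B * (real q * absv z ^ Suc k)"
        unfolding absv_mult using absv_nonneg \<open>B > 0\<close> by (intro mult_mono) auto
    qed (use \<open>B > 0\<close> absv_nonneg in simp)
    also have "\<dots> = (B * real q * absv z) * absv z ^ k" by simp
    also have "\<dots> < c * absv z ^ k"
    proof (rule mult_strict_right_mono)
      show "B * real q * absv z < c" using z(2) \<open>B > 0\<close> q by (simp add: r_def field_simps)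
    qed (use z0 in simp)
    finally have "absv S < absv (poly G z)" using r0(2)[of z] z(2) by (simp add: c_def r_def)
    hence "absv (poly G z + S) = absv (poly G z)" by (rule absv_add_eq)
    moreover have "poly G z + S = (\<Sum>j\<le>n. poly (A j) z * f_De emb z ^ j)"
      by (simp add: G_def S_def poly_sum poly_power algebra_simps sum_subtractf)
    ultimately show ?thesis using r0(2)[of z] z(2) by (simp add: c_def r_def)
  qed
  ultimately show ?thesis using c by (intro that[of r c]) (simp_all add: k_def)
qed

end

section \<open>The auxiliary polynomial and the conclusion\<close>

context completed_algebraic_closure
begin

text \<open>Supplies the sequence \<open>\<rho>\<close> of \<open>prod_fps_transcendental\<close>.
  Every root is chosen in \<open>Kbar\<close>, where the next one is known to exist.\<close>

lemma exists_root_chain: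
  obtains \<rho> where "\<rho> 0 = inverse (theta emb)" "\<And>m. \<rho> (Suc m) ^ CARD('a) = \<rho> m"
proof -
  define q where "q = CARD('a)"
  have q: "q > 1" using card_gt1 by (simp add: q_def)
  have sub: "is_subfield Kbar" and KL: "base_K emb \<subseteq> Kbar"
    using algebraic_closure by (auto simp: is_algebraic_closure_def base_K_def)
  hence Kbar: "inverse (theta emb) \<in> Kbar" "0 \<in> Kbar" "1 \<in> Kbar"
    using K_inverse_theta K_0 K_1 by blast+
  have root: "\<exists>x\<in>Kbar. x ^ q = c" if "c \<in> Kbar" for c
  proof -
    define P where "P = monom 1 q - [:c:]"
    have P: "coeff P i = (if i = q then 1 else if i = 0 then - c else 0)" for i
      using q by (auto simp: P_def coeff_pCons split: nat.splits)
    have "0 - c \<in> Kbar" using sub Kbar that unfolding is_subfield_def by blast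
    hence "\<forall>i. coeff P i \<in> Kbar" using Kbar by (simp add: P)
    moreover have "degree P > 0"
      using le_degree[of P q] q by (simp add: P)
    ultimately obtain x where "x \<in> Kbar" "poly P x = 0"
      using algebraic_closure unfolding is_algebraic_closure_def by blast
    thus ?thesis by (auto simp: P_def poly_monom)
  qed
  define \<rho> where "\<rho> = rec_nat (inverse (theta emb)) (\<lambda>_ c. SOME x. x \<in> Kbar \<and> x ^ q = c)"
  have step: "\<rho> (Suc m) = (SOME x. x \<in> Kbar \<and> x ^ q = \<rho> m)" for m by (simp add: \<rho>_def)
  have "\<rho> m \<in> Kbar \<and> \<rho> (Suc m) \<in> Kbar \<and> \<rho> (Suc m) ^ q = \<rho> m" for m
  proof (induction m)
    case 0
    have "\<rho> 0 \<in> Kbar" using Kbar by (simp add: \<rho>_def)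
    thus ?case using someI_ex[OF root[OF \<open>\<rho> 0 \<in> Kbar\<close>, unfolded Bex_def]] unfolding step by simp
  next
    case (Suc m)
    hence mem: "\<rho> (Suc m) \<in> Kbar" by simp
    thus ?case using someI_ex[OF root[OF mem, unfolded Bex_def]] unfolding step[of "Suc m"] by simp
  qed
  thus ?thesis by (intro that[of \<rho>]) (simp_all add: \<rho>_def q_def)
qed

text \<open>\<theta> is not a root of unity because its absolute value is q > 1.\<close>

lemma f_De_series_transcendental:
  assumes "(\<Sum>j\<le>n. fps_of_poly (A j) * prod_fps (theta emb) CARD('a) ^ j) = 0" "j \<le> n"
  shows "A j = 0"
proof -
  obtain \<rho> where \<rho>: "\<rho> 0 = inverse (theta emb)" "\<And>m. \<rho> (Suc m) ^ CARD('a) = \<rho> m"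
    by (rule exists_root_chain) (rule that)
  have "theta emb ^ m \<noteq> 1" if "m > 0" for m
  proof
    assume "theta emb ^ m = 1"
    hence "real CARD('a) ^ m = 1" by (metis absv_1 absv_power absv_theta)
    thus False using that card_gt1 one_less_power[of "real CARD('a)" m] by simp
  qed
  moreover have "theta emb \<noteq> 0" using absv_theta absv_0 card_gt1 by force
  ultimately show ?thesis using prod_fps_transcendental[OF card_gt1 _ _ \<rho> assms] by blast
qed

text \<open>Needed because \<open>siegel\<close> works with equations whose coefficients lie in
  F_q[\<theta>].\<close>

definition integral_series :: "'c fps \<Rightarrow> bool"
  where "integral_series f \<longleftrightarrow> (\<forall>m. f $ m \<in> range \<iota>)"

lemma range_\<iota>_mult: "x \<in> range \<iota> \<Longrightarrow> y \<in> range \<iota> \<Longrightarrow> x * y \<in> range \<iota>"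
  by (auto simp flip: \<iota>_mult)

lemma range_\<iota>_sum: "(\<And>i. i \<in> A \<Longrightarrow> f i \<in> range \<iota>) \<Longrightarrow> sum f A \<in> range \<iota>"
proof (induction A rule: infinite_finite_induct)
  case (insert i A)
  hence "f i \<in> range \<iota>" "sum f A \<in> range \<iota>" by blast+
  thus ?case using insert.hyps by (auto simp flip: \<iota>_add)
qed (auto intro: range_eqI[of _ _ 0])

lemma integral_series_mult: "integral_series f \<Longrightarrow> integral_series g \<Longrightarrow> integral_series (f * g)"
  unfolding integral_series_def fps_mult_nth by (intro allI range_\<iota>_sum range_\<iota>_mult) auto

lemma integral_series_1: "integral_series 1"
  unfolding integral_series_def by (metis \<iota>_0 \<iota>_1 fps_one_nth rangeI)

lemma integral_series_power: "integral_series f \<Longrightarrow> integral_series (f ^ n)"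
  by (induction n) (simp_all add: integral_series_1 integral_series_mult)

lemma integral_series_prod_fps: "integral_series (prod_fps (theta emb) q)"
proof -
  have "integral_series (fps_of_poly (1 - monom (theta emb) k))" for k
    unfolding integral_series_def
  proof
    fix m
    have "fps_of_poly (1 - monom (theta emb) k) $ m =
        \<iota> ((if m = 0 then 1 else 0) + (if m = k then - [:0, 1:] else 0))"
      by (simp only: \<iota>_add if_distrib[of \<iota>] \<iota>_minus \<iota>_theta \<iota>_0 \<iota>_1) simp
    thus "fps_of_poly (1 - monom (theta emb) k) $ m \<in> range \<iota>" by blast
  qed
  hence "integral_series (fps_of_poly (partial_prod (theta emb) q n))" for n
    by (induction n) (simp_all add: partial_prod_def fps_of_poly_mult integral_series_mult integral_series_1)
  thus ?thesis unfolding integral_series_def prod_fps_def by simp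
qed

text \<open>There are (N+1)^2 unknown coefficients and only N^2 linear conditions, so
  \<open>siegel\<close> applies.\<close>

lemma auxiliary_polynomial:
  assumes "N > 0"
  obtains a where "\<exists>i\<le>N. \<exists>j\<le>N. a i j \<noteq> 0"
    "\<And>m. m < N ^ 2 \<Longrightarrow>
      (\<Sum>j\<le>N. fps_of_poly (\<Sum>i\<le>N. monom (\<iota> (a i j)) i) * prod_fps (theta emb) CARD('a) ^ j) $ m = 0"
proof -
  let ?F = "prod_fps (theta emb) CARD('a)"
  have "integral_series (fps_X ^ i * ?F ^ j)" for i j
  proof (intro integral_series_mult integral_series_power integral_series_prod_fps)
    show "integral_series fps_X"
      unfolding integral_series_def by (metis \<iota>_0 \<iota>_1 fps_X_nth rangeI)
  qed
  hence "\<forall>l m. \<exists>P. (fps_X ^ fst l * ?F ^ snd l) $ m = \<iota> P"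
    unfolding integral_series_def by blast
  then obtain w where w: "\<And>l m. (fps_X ^ fst l * ?F ^ snd l) $ m = \<iota> (w l m)"
    unfolding choice_iff by blast
  define L where "L = {..N} \<times> {..N}"
  define J where "J = {..<N ^ 2}"
  define E where "E = Max ((\<lambda>(l, m). degree (w l m)) ` (L \<times> J))"
  have E: "degree (w l m) \<le> E" if "l \<in> L" "m \<in> J" for l m
    unfolding E_def using that by (intro Max_ge) (auto simp: L_def J_def)
  obtain c where c: "\<exists>l\<in>L. c l \<noteq> 0" "\<And>m. m \<in> J \<Longrightarrow> (\<Sum>l\<in>L. c l * w l m) = 0"
  proof (rule siegel)
    show "finite L" "finite J" "card J < card L" by (simp_all add: L_def J_def power2_eq_square)
    show "\<And>l m. l \<in> L \<Longrightarrow> m \<in> J \<Longrightarrow> degree (w l m) \<le> E" by (rule E)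
  qed blast
  show ?thesis
  proof (rule that[of "\<lambda>i j. c (i, j)"])
    show "\<exists>i\<le>N. \<exists>j\<le>N. c (i, j) \<noteq> 0" using c(1) by (auto simp: L_def)
    fix m assume "m < N ^ 2"
    have "(\<Sum>j\<le>N. fps_of_poly (\<Sum>i\<le>N. monom (\<iota> (c (i, j))) i) * ?F ^ j) =
        (\<Sum>j\<le>N. \<Sum>i\<le>N. fps_const (\<iota> (c (i, j))) * (fps_X ^ i * ?F ^ j))"
      by (simp add: fps_of_poly_sum fps_of_poly_monom sum_distrib_right mult.assoc)
    also have "\<dots> = (\<Sum>l\<in>L. fps_const (\<iota> (c l)) * (fps_X ^ fst l * ?F ^ snd l))"
      by (subst sum.swap) (simp add: L_def sum.cartesian_product split_beta)
    also have "\<dots> $ m = \<iota> (\<Sum>l\<in>L. c l * w l m)"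
      by (simp add: fps_sum_nth w \<iota>_sum \<iota>_mult)
    also have "\<dots> = 0" using c(2) \<open>m < N ^ 2\<close> by (simp add: J_def)
    finally show "(\<Sum>j\<le>N. fps_of_poly (\<Sum>i\<le>N. monom (\<iota> (c (i, j))) i) * ?F ^ j) $ m = 0" .
  qed
qed

section \<open>Comparison of the two bounds at \<alpha>^(q^n)\<close>

lemma f_De_transcendental:
  assumes alg: "algebraic_over (base_K emb) \<alpha>" and reg: "regular \<alpha>" and \<alpha>: "\<alpha> \<noteq> 0"
  shows "transcendental_over (base_K emb) (f_De emb \<alpha>)"
proof
  define q where "q = CARD('a)"
  define \<beta> where "\<beta> = f_De emb \<alpha>"
  have q: "q > 1" using card_gt1 by (simp add: q_def)
  have \<alpha>': "0 < absv \<alpha>" "absv \<alpha> < 1" using reg \<alpha> by (simp_all add: absv_pos_iff regular_def)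
  assume "algebraic_over (base_K emb) (f_De emb \<alpha>)"
  then obtain C where C: "\<And>M z. int_comb \<alpha> \<beta> M z \<Longrightarrow> z \<noteq> 0 \<Longrightarrow> absv z \<le> 1 \<Longrightarrow>
      1 \<le> absv z * real q ^ (C * (M + 1))"
    using liouville[OF alg] unfolding \<beta>_def q_def by blast
  \<comment> \<open>The degree bound D + 3 N q^n found below is at most 4 N q^n for large
    \<open>n\<close>, so the Liouville inequality costs \<open>q ^ (4 * C)\<close> for each unit of
    N q^n, against a gain of \<open>absv \<alpha> ^ N\<close>.\<close>
  have "(\<lambda>N. absv \<alpha> ^ N * real q ^ (4 * C)) \<longlonglongrightarrow> 0 * real q ^ (4 * C)"
    using \<alpha>' by (intro tendsto_intros LIMSEQ_realpow_zero) auto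
  hence "\<forall>\<^sub>F N in sequentially. absv \<alpha> ^ N * real q ^ (4 * C) < 1 \<and> N > 0"
    by (intro eventually_conj order_tendstoD(2)) (auto simp: eventually_gt_at_top)
  then obtain N where N: "absv \<alpha> ^ N * real q ^ (4 * C) < 1" "N > 0"
    by (auto simp: eventually_sequentially)
  obtain a where a: "\<exists>i\<le>N. \<exists>j\<le>N. a i j \<noteq> 0"
    "\<And>m. m < N ^ 2 \<Longrightarrow>
      (\<Sum>j\<le>N. fps_of_poly (\<Sum>i\<le>N. monom (\<iota> (a i j)) i) * prod_fps (theta emb) CARD('a) ^ j) $ m = 0"
    by (rule auxiliary_polynomial[OF N(2)]) (rule that)
  define A where "A j = (\<Sum>i\<le>N. monom (\<iota> (a i j)) i)" for j
  define \<Phi> where "\<Phi> = (\<Sum>j\<le>N. fps_of_poly (A j) * prod_fps (theta emb) CARD('a) ^ j)"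
  have "\<Phi> \<noteq> 0"
  proof
    assume "\<Phi> = 0"
    obtain i j where ij: "i \<le> N" "j \<le> N" "a i j \<noteq> 0" using a(1) by blast
    have "A j = 0"
      using f_De_series_transcendental \<open>\<Phi> = 0\<close> ij(2) unfolding \<Phi>_def by blast
    moreover have "coeff (A j) i = \<iota> (a i j)"
      using ij(1) by (simp add: A_def coeff_sum sum.delta if_distrib cong: if_cong)
    ultimately show False using ij(3) by simp
  qed
  then obtain r c where r: "r > 0" "c > 0" "\<And>z. regular z \<Longrightarrow> z \<noteq> 0 \<Longrightarrow> absv z < r \<Longrightarrow>
      absv (\<Sum>j\<le>N. poly (A j) z * f_De emb z ^ j) = c * absv z ^ subdegree \<Phi>"
    using absv_poly_f_De_near_0[of A N] unfolding \<Phi>_def by blast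
  have order: "N ^ 2 \<le> subdegree \<Phi>"
    using a(2) \<open>\<Phi> \<noteq> 0\<close> by (intro subdegree_geI) (simp_all add: \<Phi>_def A_def)
  \<comment> \<open>\<open>D\<close> depends on \<open>N\<close> but not on \<open>n\<close>, so it
    is eventually below \<open>q ^ n\<close>.\<close>
  define D where "D = Max ((\<lambda>(i, j). degree (a i j)) ` ({..N} \<times> {..N}))"
  have D: "degree (a i j) \<le> D" if "i \<le> N" "j \<le> N" for i j
    using that unfolding D_def by (intro Max_ge) auto
  define Q where "Q n = poly (partial_prod (theta emb) q n) \<alpha>" for n
  define z where "z n = \<alpha> ^ (q ^ n)" for n
  \<comment> \<open>As f(z_n) = \<beta> / Q_n, multiplying P(z_n, f(z_n)) by \<open>Q n ^ N\<close>
    clears the denominators and leaves a polynomial expression in \<theta>, \<alpha> and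
    \<beta>.\<close>
  define \<eta> where "\<eta> n = (\<Sum>i\<le>N. \<Sum>j\<le>N. \<iota> (a i j) * z n ^ i * \<beta> ^ j * Q n ^ (N - j))" for n
  have \<beta>: "\<beta> = Q n * f_De emb (z n)" for n
    unfolding \<beta>_def Q_def z_def q_def by (rule f_De_iterate[OF reg])
  have Q_rep: "int_comb \<alpha> \<beta> (2 * q ^ n) (Q n)" for n
  proof -
    have "int_comb \<alpha> \<beta> (q ^ Suc i) (1 - theta emb * \<alpha> ^ (q ^ Suc i))" for i
    proof -
      have "q ^ Suc i \<ge> 1" using q by simp
      hence "int_comb \<alpha> \<beta> (q ^ Suc i) (\<iota> 1 * \<alpha> ^ 0 * \<beta> ^ 0 + \<iota> (- [:0, 1:]) * \<alpha> ^ (q ^ Suc i) * \<beta> ^ 0)"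
        by (intro int_comb_add int_comb_monomial) (simp_all add: degree_minus)
      thus ?thesis by (simp only: \<iota>_minus \<iota>_theta) simp
    qed
    hence "int_comb \<alpha> \<beta> (\<Sum>i<n. q ^ Suc i) (\<Prod>i<n. 1 - theta emb * \<alpha> ^ (q ^ Suc i))"
      by (intro int_comb_prod) auto
    hence "int_comb \<alpha> \<beta> (\<Sum>i<n. q ^ Suc i) (Q n)"
      by (simp add: Q_def partial_prod_def poly_prod poly_monom)
    moreover have "(\<Sum>i<n. q ^ Suc i) \<le> 2 * q ^ n"
    proof (induction n)
      case (Suc n)
      have "2 * q ^ n \<le> q * q ^ n" using q by (intro mult_right_mono) auto
      with Suc have "(\<Sum>i<n. q ^ Suc i) + q * q ^ n \<le> 2 * (q * q ^ n)" by linarith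
      thus ?case by simp
    qed simp
    ultimately show ?thesis by (rule int_comb_mono)
  qed
  have \<eta>_rep: "int_comb \<alpha> \<beta> (D + 3 * N * q ^ n) (\<eta> n)" for n
    unfolding \<eta>_def
  proof (intro int_comb_sum)
    fix i j assume ij: "i \<in> {..N}" "j \<in> {..N}"
    have "int_comb \<alpha> \<beta> (D + i * q ^ n + j) (\<iota> (a i j) * \<alpha> ^ (i * q ^ n) * \<beta> ^ j)"
      using D[of i j] ij by (intro int_comb_monomial) auto
    from int_comb_mult[OF this int_comb_power[OF Q_rep[of n], of "N - j"]]
    have "int_comb \<alpha> \<beta> (D + i * q ^ n + j + (N - j) * (2 * q ^ n))
        (\<iota> (a i j) * z n ^ i * \<beta> ^ j * Q n ^ (N - j))"
      by (simp add: z_def mult.commute flip: power_mult)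
    \<comment> \<open>The power of \<alpha> in \<open>z n ^ i\<close> costs at most N q^n;
      \<open>\<beta> ^ j\<close> and \<open>Q n ^ (N - j)\<close> together cost at most 2 N
      q^n.\<close>
    moreover have "D + i * q ^ n + j + (N - j) * (2 * q ^ n) \<le> D + 3 * N * q ^ n"
    proof -
      have "j * 1 \<le> j * (2 * q ^ n)" using q by (intro mult_left_mono) auto
      hence "j + (N - j) * (2 * q ^ n) \<le> j * (2 * q ^ n) + (N - j) * (2 * q ^ n)" by simp
      also have "\<dots> = N * (2 * q ^ n)" using ij by (simp flip: distrib_right)
      finally have "j + (N - j) * (2 * q ^ n) \<le> N * (2 * q ^ n)" .
      moreover have "i * q ^ n \<le> N * q ^ n" using ij by simp
      moreover have "3 * N * q ^ n = N * q ^ n + N * (2 * q ^ n)" by simp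
      ultimately show ?thesis by linarith
    qed
    ultimately show "int_comb \<alpha> \<beta> (D + 3 * N * q ^ n) (\<iota> (a i j) * z n ^ i * \<beta> ^ j * Q n ^ (N - j))"
      by (rule int_comb_mono)
  qed
  have \<eta>: "\<eta> n = Q n ^ N * (\<Sum>j\<le>N. poly (A j) (z n) * f_De emb (z n) ^ j)" for n
  proof -
    have "\<iota> (a i j) * z n ^ i * \<beta> ^ j * Q n ^ (N - j) =
        Q n ^ N * (\<iota> (a i j) * z n ^ i * f_De emb (z n) ^ j)" if "j \<le> N" for i j
    proof -
      have "\<beta> ^ j * Q n ^ (N - j) = (Q n ^ j * Q n ^ (N - j)) * f_De emb (z n) ^ j"
        by (subst \<beta>[of n]) (simp add: power_mult_distrib)
      also have "Q n ^ j * Q n ^ (N - j) = Q n ^ N" using that by (simp flip: power_add)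
      finally show ?thesis by (simp add: mult_ac)
    qed
    hence "\<eta> n = (\<Sum>i\<le>N. \<Sum>j\<le>N. Q n ^ N * (\<iota> (a i j) * z n ^ i * f_De emb (z n) ^ j))"
      unfolding \<eta>_def by (intro sum.cong refl) simp
    also have "\<dots> = (\<Sum>j\<le>N. \<Sum>i\<le>N. Q n ^ N * (\<iota> (a i j) * z n ^ i * f_De emb (z n) ^ j))"
      by (rule sum.swap)
    also have "\<dots> = Q n ^ N * (\<Sum>j\<le>N. poly (A j) (z n) * f_De emb (z n) ^ j)"
      by (simp add: A_def poly_sum poly_monom sum_distrib_left sum_distrib_right mult.assoc)
    finally show ?thesis .
  qed
  have z: "regular (z n)" "z n \<noteq> 0" for n
    using regular_power[OF reg] \<alpha> by (simp_all add: z_def q_def)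
  have q_pow: "filterlim (\<lambda>n. q ^ n) at_top sequentially"
    using q by (intro filterlim_subseq) (simp add: strict_mono_def)
  have z_lim: "(\<lambda>n. absv (z n)) \<longlonglongrightarrow> 0"
    unfolding z_def absv_power
    using \<alpha>' by (intro filterlim_compose[OF _ q_pow] LIMSEQ_realpow_zero) auto
  \<comment> \<open>For large \<open>n\<close>, f(z_n) has absolute value 1, so |Q_n| = |\<beta>|;
    this explains \<open>absv \<beta> ^ N\<close>.\<close>
  define K where "K = absv \<beta> ^ N * c"
  define R where "R = absv \<alpha> ^ N * real q ^ (4 * C)"
  have near: "\<forall>\<^sub>F n in sequentially. absv (z n) < min r (1 / real q)"
    using r(1) q by (intro order_tendstoD(2)[OF z_lim]) auto
  have \<eta>_bound: "\<forall>\<^sub>F n in sequentially. \<eta> n \<noteq> 0 \<and> absv (\<eta> n) \<le> K * (absv \<alpha> ^ N) ^ (N * q ^ n)"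
    using near
  proof eventually_elim
    case (elim n)
    have z0: "absv (z n) > 0" using z by (simp add: absv_pos_iff)
    have z1: "absv (z n) < 1" using z(1) by (simp add: regular_def)
    have "absv (z n) ^ q \<le> absv (z n) ^ 1" using z0 z1 q by (intro power_decreasing) auto
    also have "\<dots> < 1 / real q" using elim by simp
    finally have "real q * absv (z n) ^ q < 1" using q by (simp add: field_simps)
    hence "absv (f_De emb (z n)) = 1" using absv_f_De_eq_1[OF z(1)] by (simp add: q_def)
    hence Q\<beta>: "absv (Q n) = absv \<beta>" using arg_cong[OF \<beta>[of n], of absv] by (simp add: absv_mult)
    have "\<beta> \<noteq> 0"
    proof
      assume "\<beta> = 0"
      hence "Q n = 0" using Q\<beta> by (simp add: absv_0 absv_eq_0_iff)
      then obtain i where "1 - theta emb * \<alpha> ^ (q ^ Suc i) = 0"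
        by (auto simp: Q_def partial_prod_def poly_prod poly_monom)
      moreover have "Suc i \<ge> 1" by simp
      ultimately show False using reg unfolding regular_def q_def by (metis right_minus_eq)
    qed
    hence "absv \<beta> > 0" by (simp add: absv_pos_iff)
    have eq: "absv (\<eta> n) = K * absv (z n) ^ subdegree \<Phi>"
      using r(3)[OF z, of n] elim by (simp add: \<eta> absv_mult absv_power Q\<beta> K_def)
    have "K > 0" using \<open>absv \<beta> > 0\<close> r(2) by (simp add: K_def)
    have "absv (\<eta> n) > 0" unfolding eq using \<open>K > 0\<close> z0 by simp
    hence "\<eta> n \<noteq> 0" by (simp add: absv_pos_iff)
    moreover have "absv (z n) ^ subdegree \<Phi> \<le> absv (z n) ^ (N ^ 2)"
      using z0 z1 order by (intro power_decreasing) auto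
    moreover have "absv (z n) ^ (N ^ 2) = (absv \<alpha> ^ N) ^ (N * q ^ n)"
      by (simp add: z_def absv_power power2_eq_square mult_ac flip: power_mult)
    ultimately show ?case using \<open>K > 0\<close> by (simp add: eq)
  qed
  have lim: "(\<lambda>n. x ^ (N * q ^ n)) \<longlonglongrightarrow> 0" if "0 \<le> x" "x < 1" for x :: real
  proof (rule filterlim_compose[of "\<lambda>n. x ^ n"])
    show "(\<lambda>n. x ^ n) \<longlonglongrightarrow> 0" using that by (intro LIMSEQ_realpow_zero) auto
    show "filterlim (\<lambda>n. N * q ^ n) at_top sequentially"
      using N(2) by (intro filterlim_at_top_mono[OF q_pow]) auto
  qed
  have R_lim: "(\<lambda>n. R ^ (N * q ^ n)) \<longlonglongrightarrow> 0"
    using N(1) \<alpha>' by (intro lim) (simp_all add: R_def)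
  have \<alpha>_lim: "(\<lambda>n. (absv \<alpha> ^ N) ^ (N * q ^ n)) \<longlonglongrightarrow> 0"
    using \<alpha>' N(2) power_Suc_less_one[of "absv \<alpha>" "N - 1"] by (intro lim) simp_all
  have "(\<lambda>n. K * (absv \<alpha> ^ N) ^ (N * q ^ n)) \<longlonglongrightarrow> K * 0"
    by (intro tendsto_intros \<alpha>_lim)
  \<comment> \<open>This gives \<open>absv (\<eta> n) \<le> 1\<close>, which the Liouville
    inequality requires.\<close>
  hence small: "\<forall>\<^sub>F n in sequentially. K * (absv \<alpha> ^ N) ^ (N * q ^ n) < 1"
    by (intro order_tendstoD(2)) auto
  \<comment> \<open>The sequence bounds the product of \<open>absv (\<eta> n)\<close> and its
    Liouville factor, which should be at least 1.\<close>
  have "(\<lambda>n. K * real q ^ C * R ^ (N * q ^ n)) \<longlonglongrightarrow> K * real q ^ C * 0"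
    by (intro tendsto_intros R_lim)
  hence "\<forall>\<^sub>F n in sequentially. K * real q ^ C * R ^ (N * q ^ n) < 1"
    by (intro order_tendstoD(2)) auto
  moreover have "\<forall>\<^sub>F n in sequentially. D \<le> q ^ n"
    using q_pow by (simp add: filterlim_at_top)
  ultimately have "\<forall>\<^sub>F n in sequentially. False"
    using small \<eta>_bound
  proof eventually_elim
    case (elim n)
    have "D \<le> N * q ^ n" using elim(2) N(2) by (metis One_nat_def Suc_leI le_trans mult_1 mult_le_mono1)
    hence M: "C * (D + 3 * N * q ^ n + 1) \<le> C + 4 * C * (N * q ^ n)" by (simp add: algebra_simps)
    have "absv (\<eta> n) \<le> 1" using elim by linarith
    hence "1 \<le> absv (\<eta> n) * real q ^ (C * (D + 3 * N * q ^ n + 1))"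
      using C[OF \<eta>_rep[of n]] elim by blast
    also have "\<dots> \<le> (K * (absv \<alpha> ^ N) ^ (N * q ^ n)) * real q ^ (C + 4 * C * (N * q ^ n))"
      using elim M q absv_nonneg[of "\<eta> n"] order_trans[OF absv_nonneg, of "\<eta> n"]
      by (intro mult_mono power_increasing) auto
    also have "\<dots> = K * real q ^ C * R ^ (N * q ^ n)"
    proof -
      have "R ^ m = (absv \<alpha> ^ N) ^ m * real q ^ (4 * C * m)" for m
        by (simp only: R_def power_mult_distrib power_mult[of "real q" "4 * C" m])
      thus ?thesis unfolding power_add by (simp only: mult_ac)
    qed
    finally show ?case using elim by linarith
  qed
  thus False by simp
qed

end

unbundle no fps_syntax
unbundle vec_syntax

theorem theorem5:
  fixes p e :: nat
    and emb :: "'a::finite_field fls \<Rightarrow> 'c::{field, complete_space}"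
    and absv :: "'c \<Rightarrow> real"
    and Kbar :: "'c set"
  assumes "prime p" and "e > 0" and "CARD('a) = p ^ e"
    and "completed_algebraic_closure emb absv Kbar"
  shows "(\<forall>x. absv x < 1 \<longrightarrow> convergent_prod (f_De_factor emb x)) \<and>
    (\<forall>\<alpha>\<in>K_alg emb. 0 < absv \<alpha> \<and> absv \<alpha> < 1 \<and>
        (\<forall>n\<ge>1. theta emb * \<alpha> ^ (CARD('a) ^ n) \<noteq> 1) \<longrightarrow>
      transcendental_over (base_K emb) (f_De emb \<alpha>))"
proof -
  interpret completed_algebraic_closure emb absv Kbar by (rule assms(4))
  have "transcendental_over (base_K emb) (f_De emb \<alpha>)"
    if "\<alpha> \<in> K_alg emb" "0 < absv \<alpha>" "absv \<alpha> < 1" "\<forall>n\<ge>1. theta emb * \<alpha> ^ (CARD('a) ^ n) \<noteq> 1" for \<alpha>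
    using that by (intro f_De_transcendental) (auto simp: K_alg_def regular_def absv_0)
  thus ?thesis using convergent_prod_f_De by blast
qed

end
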